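(* Let $(a_j)_{j=1}^\infty \in \mathcal{M}$. Then the sum $$\sum_{j=1}^{\infty} a_j F_j = L$$ is convergent, with $L \in \mathcal{A}$, and $\mathrm{w}_L(j) = a_j$ for all $j \ge 1$. Furthermore, the map $$\eta : \mathcal{M} \to \mathcal{A}, \qquad \eta\big((a_j)_{j=1}^\infty\big) = \sum_{j=1}^\infty a_j F_j$$ is an isomorphism of topological monoids, which for any positive integer $n$ restricts to an isomorphism of discrete, free abelian monoids of finite rank $$\eta : \mathcal{M}_n \to \mathcal{A}_n, \qquad \eta\big((a_j)_{j=1}^\infty\big) = \sum_{j=1}^\infty a_j F_j = \sum_{j=1}^n a_j F_j .$$
   Context: $\mathbb{N} = \{0,1,2,\dots\}$, $\mathbb{N}_+ = \{1,2,\dots\}$. For $L_1, L_2 \subset \mathbb{Z}^2$, $L_1 + L_2 = \{u+v : u\in L_1, v\in L_2\}$; for $a\in\mathbb{N}$, $aL$ denotes the sum of $a$ copies of $L$, the empty sum being the identity $\mathbb{N}^2$. The monoid $\mathcal{M}$: $\mathcal{M} = \mathbb{N}^{\mathbb{N}_+}$ is the monoid of all sequences of non-negative integers under componentwise addition, with the product topology ($\mathbb{N}$ discrete). $\mathcal{M}_n = \{(a_j)_{j\ge1} \in \mathcal{M} : a_j = 0 \text{ for } j > n\}$. The set $\mathcal{A}$: A monoid submodule is a subset $L \subset \mathbb{Z}^2$ with $L + \mathbb{N}^2 \subset L$. It is co-artinian if it contains no infinite strictly descending chain for the componentwise order. It is integrally closed if $L = \operatorname{conv}(L)\cap\mathbb{Z}^2$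 (convex hull in $\mathbb{R}^2$). Put $\mathrm{New}(L) = \operatorname{conv}(L)\subset\mathbb{R}^2$. $\mathcal{A}$ is the collection of all $L\subset\mathbb{Z}^2$ such that 1. $L$ is a monoid submodule; 2. $L$ is co-artinian; 3. $L$ is integrally closed; 4. $\mathbb{N}^2 \subset L$, every $(a,b)\in L$ has $a\ge 0$, and $(0,b)\in L$ implies $b \ge 0$; 5. $P=\mathrm{New}(L)$ contains no infinite ray $\{t(a,b) : t\ge 0\}$ with $b<0<a$; 6. $P$ has no infinite facet except the positive $y$-axis and (possibly) an infinite ray parallel to the $x$-axis; 7. every finite facet of $P$ is a line segment joining vertices $(c,d)$ and $(c+mk, d-m)$ for some positive integers $k,m$ and integers $d\le 0\le c$; i.e. it has outward normal $(-1,-k)$. For $n\ge1$, $\mathcal{A}_n$ is the set of those $L\in\mathcal{A}$ for which the outward normals of the finite facets of $\mathrm{New}(L)$ all belong to $\{(-1,-k) : 1\le k\le n\}$. The monoid operation on $\mathcal{A}$ and $\mathcal{A}_n$ is addition of subsets of $\mathbb{Z}^2$. Topology: $\mathcal{A}$ has the subspace topology via the embedding $L \mapsto \chi_L=\sum_{\alpha\in L} x^\alpha$ into $\mathbb{Z}^{\mathbb{Z}^2}$ (formal sums of Laurent monomials with integer coefficients) with the product topology, $\mathbb{Z}$ discrete. $\mathcal{A}_n$ has the subspace topology. An infinite sum converges to $L$ if its partial sums converge to $L$ in $\mathcal{A}$. The elements $F_j$: for $j\ge1$, $F_j = (0,-1) + \log(E_{(j,1)})$, where $E_{(j,1)}$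 is the integral closure of the ideal $(x^j,y)\subset\mathbb{C}[x,y]$ and $\log$ denotes the set of exponent vectors of monomials in it; thus $F_j = \mathbb{N}^2\cup\big((j,-1)+\mathbb{N}^2\big)$. The multiplicities $\mathrm{w}$: for $M\in\mathcal{A}$ and an integer $c\ge0$ let $M(c) = \{(a,b)\in M : b\ge -c\}$. For $n\ge1$ let $\rho_n(M) = M(c(n))$, where $c(n)$ is the largest $c$ such that $\mathrm{New}(M(c))$ has no boundary segment with outward normal $(-1,-k)$ with $k>n$; if no largest such $c$ exists (i.e. $M\in\mathcal{A}_n$), $\rho_n(M)=M$. Then $\rho_n(M)\in\mathcal{A}_n$ and $\rho_n(M) = \sum_{j=1}^n \mathrm{w}_M(j,n) F_j$ for unique non-negative integers $\mathrm{w}_M(j,n)$. The value $\mathrm{w}_M(j,n)$ is the same for all $n\ge j$, and $\mathrm{w}_M(j)$ denotes this common value. *)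

theory Defs
  imports
    "HOL-Analysis.Analysis"
    "HOL-Algebra.Product_Groups"
    "HOL-Algebra.Ideal_Product"
    "HOL-Algebra.Algebraic_Closure_Type"
    "HOL-Library.Set_Algebras"
    "HOL-Library.Product_Order"
begin

section \<open>Topological and free abelian monoids\<close>

definition topological_monoid :: "('a, 'c) monoid_scheme \<Rightarrow> 'a topology \<Rightarrow> bool" where
  "topological_monoid G T \<longleftrightarrow>
     Group.monoid G \<and> topspace T = carrier G \<and>
     continuous_map (prod_topology T T) T (\<lambda>(x, y). x \<otimes>\<^bsub>G\<^esub> y)"

definition topological_monoid_iso ::
  "('a, 'c) monoid_scheme \<Rightarrow> 'a topology \<Rightarrow> ('b, 'd) monoid_scheme \<Rightarrow> 'b topology \<Rightarrow> ('a \<Rightarrow> 'b) \<Rightarrow> bool"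
  where
  "topological_monoid_iso G S H T h \<longleftrightarrow>
     topological_monoid G S \<and> topological_monoid H T \<and> h \<in> iso G H \<and> homeomorphic_map S T h"

definition free_comm_monoid_finite_rank :: "('a, 'c) monoid_scheme \<Rightarrow> bool" where
  "free_comm_monoid_finite_rank G \<longleftrightarrow>
     Group.comm_monoid G \<and>
     (\<exists>B. finite B \<and> B \<subseteq> carrier G \<and>
        (\<forall>x\<in>carrier G. \<exists>!f. f \<in> B \<rightarrow>\<^sub>E (UNIV :: nat set) \<and>
           x = finprod G (\<lambda>b. b [^]\<^bsub>G\<^esub> f b) B))"


section \<open>The monoid of sequences\<close>

definition nat_add_monoid :: "nat monoid" where
  "nat_add_monoid = \<lparr>carrier = UNIV, monoid.mult = (+), one = 0\<rparr>"

text \<open>Sequences indexed by the positive integers are functions on \<open>{1..}\<close>, extensional as usual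
  for \<^const>\<open>product_group\<close> and \<^const>\<open>product_topology\<close>.\<close>

definition \<M> :: "(nat \<Rightarrow> nat) monoid" where
  "\<M> = product_group {1..} (\<lambda>_. nat_add_monoid)"

definition \<M>_topology :: "(nat \<Rightarrow> nat) topology" where
  "\<M>_topology = product_topology (\<lambda>_. discrete_topology UNIV) {1..}"

definition \<M>_upto :: "nat \<Rightarrow> (nat \<Rightarrow> nat) monoid" where
  "\<M>_upto n = \<M>\<lparr>carrier := {a \<in> carrier \<M>. \<forall>j>n. a j = 0}\<rparr>"


section \<open>Submodules of the integer lattice and their Newton polyhedra\<close>

text \<open>Addition of sets is the pointwise one of \<^theory>\<open>HOL-Library.Set_Algebras\<close>, and the order on
  pairs is the componentwise one of \<^theory>\<open>HOL-Library.Product_Order\<close>.\<close>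

definition quadrant :: "(int \<times> int) set" where
  "quadrant = {(a, b). 0 \<le> a \<and> 0 \<le> b}"

definition monoid_submodule :: "(int \<times> int) set \<Rightarrow> bool" where
  "monoid_submodule L \<longleftrightarrow> L + quadrant \<subseteq> L"

text \<open>The neutral element is the quadrant, so that empty sums are the quadrant; the zero of
  \<^theory>\<open>HOL-Library.Set_Algebras\<close>, which is a singleton, is not used.\<close>

definition submodule_monoid :: "(int \<times> int) set monoid" where
  "submodule_monoid = \<lparr>carrier = {L. monoid_submodule L}, monoid.mult = (+), one = quadrant\<rparr>"

definition co_artinian :: "(int \<times> int) set \<Rightarrow> bool" where
  "co_artinian L \<longleftrightarrow> (\<nexists>f :: nat \<Rightarrow> int \<times> int. (\<forall>n. f n \<in> L) \<and> (\<forall>n. f (Suc n) < f n))"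

definition real_point :: "int \<times> int \<Rightarrow> real \<times> real" where
  "real_point p = (real_of_int (fst p), real_of_int (snd p))"

definition New :: "(int \<times> int) set \<Rightarrow> (real \<times> real) set" where
  "New L = convex hull (real_point ` L)"

definition integrally_closed :: "(int \<times> int) set \<Rightarrow> bool" where
  "integrally_closed L \<longleftrightarrow> L = {p. real_point p \<in> New L}"

definition finite_facet :: "(real \<times> real) set \<Rightarrow> (real \<times> real) set \<Rightarrow> bool" where
  "finite_facet F P \<longleftrightarrow> F facet_of P \<and> bounded F"

definition infinite_facet :: "(real \<times> real) set \<Rightarrow> (real \<times> real) set \<Rightarrow> bool" where
  "infinite_facet F P \<longleftrightarrow> F facet_of P \<and> \<not> bounded F"

definition outward_normal :: "(real \<times> real) set \<Rightarrow> (real \<times> real) set \<Rightarrow> real \<times> real \<Rightarrow> bool" where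
  "outward_normal P F v \<longleftrightarrow>
     v \<noteq> 0 \<and> (\<exists>s. P \<subseteq> {x. v \<bullet> x \<le> s} \<and> F = P \<inter> {x. v \<bullet> x = s})"

definition \<A> :: "(int \<times> int) set set" where
  "\<A> = {L.
     monoid_submodule L \<and>
     co_artinian L \<and>
     integrally_closed L \<and>
     (quadrant \<subseteq> L \<and> (\<forall>(a, b)\<in>L. 0 \<le> a) \<and> (\<forall>b. (0, b) \<in> L \<longrightarrow> 0 \<le> b)) \<and>
     (\<nexists>a b :: real. b < 0 \<and> 0 < a \<and> {t *\<^sub>R (a, b) |t. 0 \<le> t} \<subseteq> New L) \<and>
     (\<forall>F. infinite_facet F (New L) \<longrightarrow>
        F = {(0, y) |y. 0 \<le> y} \<or>
        (\<exists>p s. s \<noteq> 0 \<and> F = {p + t *\<^sub>R (s, 0) |t. 0 \<le> t})) \<and>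
     (\<forall>F. finite_facet F (New L) \<longrightarrow>
        (\<exists>k m c d :: int. 0 < k \<and> 0 < m \<and> d \<le> 0 \<and> 0 \<le> c \<and>
           real_point (c, d) extreme_point_of New L \<and>
           real_point (c + m * k, d - m) extreme_point_of New L \<and>
           F = closed_segment (real_point (c, d)) (real_point (c + m * k, d - m))))}"

definition \<A>_upto :: "nat \<Rightarrow> (int \<times> int) set set" where
  "\<A>_upto n = {L \<in> \<A>. \<forall>F. finite_facet F (New L) \<longrightarrow>
     (\<exists>k\<in>{1..n}. outward_normal (New L) F (-1, - real k))}"

definition \<A>_monoid :: "(int \<times> int) set monoid" where
  "\<A>_monoid = submodule_monoid\<lparr>carrier := \<A>\<rparr>"

definition \<A>_upto_monoid :: "nat \<Rightarrow> (int \<times> int) set monoid" where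
  "\<A>_upto_monoid n = submodule_monoid\<lparr>carrier := \<A>_upto n\<rparr>"

text \<open>The topology induced by the embedding of \<open>\<A>\<close> into the formal sums of Laurent
  monomials with integer coefficients, which are the functions from exponents to integers.\<close>

definition \<A>_topology :: "(int \<times> int) set topology" where
  "\<A>_topology =
     pullback_topology \<A> (\<lambda>L. indicator L :: int \<times> int \<Rightarrow> int)
       (product_topology (\<lambda>_. discrete_topology UNIV) UNIV)"

definition \<A>_upto_topology :: "nat \<Rightarrow> (int \<times> int) set topology" where
  "\<A>_upto_topology n = subtopology \<A>_topology (\<A>_upto n)"


section \<open>The generators\<close>

text \<open>Polynomials in \<open>x, y\<close> are polynomials in \<open>y\<close> over the polynomials in \<open>x\<close>.\<close>

definition monomial_xy :: "nat \<Rightarrow> nat \<Rightarrow> complex poly poly" where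
  "monomial_xy a b = Polynomial.monom (Polynomial.monom 1 a) b"

abbreviation polys_xy :: "complex poly poly ring" where
  "polys_xy \<equiv> ring_of_type_algebra"

definition ideal_integral_closure :: "complex poly poly set \<Rightarrow> complex poly poly set" where
  "ideal_integral_closure I =
     {r. \<exists>n>0. \<exists>c. (\<forall>i\<in>{1..n}. c i \<in> I [^]\<^bsub>ideals_set polys_xy\<^esub> i) \<and>
         r ^ n + (\<Sum>i = 1..n. c i * r ^ (n - i)) = 0}"

definition E :: "nat \<Rightarrow> complex poly poly set" where
  "E j = ideal_integral_closure (Idl\<^bsub>polys_xy\<^esub> {monomial_xy j 0, monomial_xy 0 1})"

definition log_ideal :: "complex poly poly set \<Rightarrow> (int \<times> int) set" where
  "log_ideal I = {(int a, int b) |a b. monomial_xy a b \<in> I}"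

definition F :: "nat \<Rightarrow> (int \<times> int) set" where
  "F j = (\<lambda>p. (0, -1) + p) ` log_ideal (E j)"

text \<open>The ideal of polynomials whose part not involving \<open>y\<close> vanishes to order \<open>m\<close> at
  \<open>x = 0\<close>, used to compute \<open>F j\<close> below.\<close>

definition x_order_ge :: "nat \<Rightarrow> complex poly poly set" where
  "x_order_ge m = {r. \<forall>i<m. Polynomial.coeff (Polynomial.coeff r 0) i = 0}"

lemma polys_xy_cring: "cring polys_xy" by (rule cring_from_type_algebra)

lemma polys_xy_simps: "carrier polys_xy = UNIV" "x \<otimes>\<^bsub>polys_xy\<^esub> y = x * y" "x \<oplus>\<^bsub>polys_xy\<^esub> y = x + y" "\<one>\<^bsub>polys_xy\<^esub> = 1" "\<zero>\<^bsub>polys_xy\<^esub> = 0"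
  by (auto simp: ring_of_type_algebra_def)

lemma x_order_ge_mult: assumes "r \<in> x_order_ge m" "s \<in> x_order_ge n" shows "r * s \<in> x_order_ge (m+n)"
proof -
  have "(\<Sum>k\<le>i. poly.coeff (poly.coeff r 0) k * poly.coeff (poly.coeff s 0) (i - k)) = 0" if i: "i < m+n" for i
  proof (rule sum.neutral, rule)
    fix k assume "k \<in> {..i}"
    then have "k < m \<or> i - k < n" using i by auto
    then show "poly.coeff (poly.coeff r 0) k * poly.coeff (poly.coeff s 0) (i - k) = 0"
      using assms by (auto simp: x_order_ge_def)
  qed
  then show ?thesis by (auto simp: x_order_ge_def Polynomial.coeff_mult coeff_mult_0)
qed

lemma x_order_ge_ideal: "ideal (x_order_ge m) polys_xy"
proof -
  interpret cring polys_xy by (rule polys_xy_cring)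
  have neg: "\<ominus>\<^bsub>polys_xy\<^esub> x = - x" for x
    by (rule minus_equality) (auto simp: polys_xy_simps)
  have m: "a * x \<in> x_order_ge m" if "a \<in> x_order_ge m" for a x using x_order_ge_mult[of a m x 0] that by (simp add: x_order_ge_def)
  have "subgroup (x_order_ge m) (add_monoid polys_xy)"
    by (rule add.subgroupI) (auto simp: polys_xy_simps a_inv_def[symmetric] neg x_order_ge_def intro: exI[of _ 0])
  then show ?thesis
    by (rule idealI[OF ring_axioms]) (auto simp: polys_xy_simps m mult.commute[of _ "_ :: complex poly poly"] dest: m)
qed

lemma log_E: "log_ideal (E j) = {(a,b). 0 \<le> a \<and> 0 \<le> b \<and> (int j \<le> a \<or> 1 \<le> b)}"
proof -
  interpret cring polys_xy by (rule polys_xy_cring)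
  define I where "I = Idl\<^bsub>polys_xy\<^esub> {monomial_xy j 0, monomial_xy 0 1}"
  have Iid: "ideal I polys_xy" unfolding I_def by (rule genideal_ideal) (simp add: polys_xy_simps)
  have gen: "monomial_xy j 0 \<in> I" "monomial_xy 0 1 \<in> I"
    using genideal_self[of "{monomial_xy j 0, monomial_xy 0 1}"] by (auto simp: I_def polys_xy_simps)
  have ImJ: "I \<subseteq> x_order_ge j" unfolding I_def
    by (rule genideal_minimal[OF x_order_ge_ideal]) (auto simp: x_order_ge_def monomial_xy_def)
  have pJ: "I [^]\<^bsub>ideals_set polys_xy\<^esub> i \<subseteq> x_order_ge (j*i)" for i :: nat
  proof (induction i)
    case 0 show ?case by (auto simp: x_order_ge_def)
  next
    case (Suc i)
    have "x \<in> x_order_ge (j * Suc i)" if "x \<in> ideal_prod polys_xy (I [^]\<^bsub>ideals_set polys_xy\<^esub> i) I" for x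
      using that
    proof induction
      case (prod a b)
      then show ?case using x_order_ge_mult[of a "j*i" b j] Suc ImJ by (auto simp: polys_xy_simps add.commute)
    next
      case (sum a b) then show ?case by (auto simp: polys_xy_simps x_order_ge_def)
    qed
    then show ?case by (auto simp: ideals_set_def)
  qed
  have mm: "monomial_xy a b * monomial_xy c d = monomial_xy (a+c) (b+d)" for a b c d
    by (simp add: monomial_xy_def Polynomial.mult_monom)
  have up: "monomial_xy a b \<in> E j" if "j \<le> a \<or> 1 \<le> b" for a b
  proof -
    have "monomial_xy a b \<in> I"
    proof (cases "j \<le> a")
      case True then show ?thesis
        using ideal.I_l_closed[OF Iid gen(1), of "monomial_xy (a-j) b"] by (simp add: polys_xy_simps mm)
    next
      case False then show ?thesis
        using that ideal.I_l_closed[OF Iid gen(2), of "monomial_xy a (b-1)"] by (simp add: polys_xy_simps mm)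
    qed
    then have n: "- monomial_xy a b \<in> I"
      using ideal.I_l_closed[OF Iid, of _ "-1"] by (fastforce simp add: polys_xy_simps)
    have "- monomial_xy a b \<in> I [^]\<^bsub>ideals_set polys_xy\<^esub> (1::nat)"
      using ideal_prod.prod[of 1 UNIV "- monomial_xy a b" I polys_xy] n
      by (simp add: ideals_set_def polys_xy_simps)
    then show ?thesis
      unfolding E_def ideal_integral_closure_def I_def[symmetric]
      by (intro CollectI exI[of _ 1] conjI exI[of _ "\<lambda>_. - monomial_xy a b"]) auto
  qed
  have dn: "False" if mE: "monomial_xy a 0 \<in> E j" and "a < j" for a
  proof -
    obtain n c where n: "n > 0" and c0: "\<forall>i\<in>{1..n}. c i \<in> I [^]\<^bsub>ideals_set polys_xy\<^esub> i"
      and eq: "monomial_xy a 0 ^ n + (\<Sum>i = 1..n. c i * monomial_xy a 0 ^ (n - i)) = 0"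
      using mE unfolding E_def ideal_integral_closure_def I_def[symmetric] mem_Collect_eq by blast
    note c = bspec[OF c0]
    have pw: "monomial_xy a 0 ^ k = monomial_xy (a*k) 0" for k
    proof (induction k)
      case 0 show ?case unfolding monomial_xy_def power_0 mult_0_right Polynomial.monom_eq_1 ..
    next
      case (Suc k) then show ?case by (simp only: power_Suc mm mult_Suc_right add_0)
    qed
    have z: "poly.coeff (poly.coeff (c i * monomial_xy a 0 ^ (n - i)) 0) (a*n) = 0" if i: "i \<in> {1..n}" for i
    proof -
      have "a * i < j * i" using i \<open>a < j\<close> by auto
      then have "poly.coeff (poly.coeff (c i) 0) (a*i) = 0" using c[OF i] pJ[of i] by (auto simp: x_order_ge_def)
      moreover have d: "a*n - a*(n-i) = a*i"
      proof -
        obtain k where "n = i + k" using i le_Suc_ex by auto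
        then show ?thesis by (simp add: distrib_left)
      qed
      moreover have "poly.coeff (c i * monomial_xy (a*(n-i)) 0) 0 = Polynomial.monom 1 (a*(n-i)) * poly.coeff (c i) 0"
        by (simp only: coeff_mult_0 monomial_xy_def Polynomial.coeff_monom if_True refl mult.commute)
      moreover have "a*(n-i) \<le> a*n" by (rule mult_le_mono2) simp
      ultimately show ?thesis
        unfolding pw by (simp only: Polynomial.coeff_monom_mult if_True refl d mult_1_left if_cancel)
    qed
    have "poly.coeff (poly.coeff (monomial_xy a 0 ^ n + (\<Sum>i = 1..n. c i * monomial_xy a 0 ^ (n - i))) 0) (a*n) = 1"
    proof -
      have "poly.coeff (poly.coeff (monomial_xy a 0 ^ n) 0) (a*n) = 1"
        unfolding pw by (simp only: monomial_xy_def Polynomial.coeff_monom if_True refl)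
      moreover have "(\<Sum>i = 1..n. poly.coeff (poly.coeff (c i * monomial_xy a 0 ^ (n - i)) 0) (a*n)) = 0"
        by (intro sum.neutral ballI z)
      ultimately show ?thesis by (simp only: Polynomial.coeff_add Polynomial.coeff_sum add_0_right)
    qed
    then show False unfolding eq by simp
  qed
  show ?thesis
  proof (intro Set.set_eqI iffI)
    fix p :: "int \<times> int" assume "p \<in> log_ideal (E j)"
    then obtain a b where "p = (int a, int b)" "monomial_xy a b \<in> E j" by (auto simp: log_ideal_def)
    then show "p \<in> {(a,b). 0 \<le> a \<and> 0 \<le> b \<and> (int j \<le> a \<or> 1 \<le> b)}"
      using dn[of a] by (cases "b = 0") (auto simp: not_less[symmetric])
  next
    fix p :: "int \<times> int" assume p: "p \<in> {(a,b). 0 \<le> a \<and> 0 \<le> b \<and> (int j \<le> a \<or> 1 \<le> b)}"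
    then have "monomial_xy (nat (fst p)) (nat (snd p)) \<in> E j" by (intro up) auto
    then show "p \<in> log_ideal (E j)" using p unfolding log_ideal_def by (intro CollectI exI[of _ "nat (fst p)"] exI[of _ "nat (snd p)"]) auto
  qed
qed

lemma F_eq: "F j = quadrant \<union> (\<lambda>p. (int j, -1) + p) ` quadrant"
proof -
  have "F j = {(a, b). 0 \<le> a \<and> -1 \<le> b \<and> (int j \<le> a \<or> 0 \<le> b)}" (is "_ = ?X")
  proof (intro Set.set_eqI iffI)
    fix p :: "int \<times> int" assume "p \<in> F j" then show "p \<in> ?X" by (auto simp: F_def log_E)
  next
    fix p :: "int \<times> int" assume "p \<in> ?X"
    then show "p \<in> F j" unfolding F_def log_E
      by (intro image_eqI[of _ _ "(0, 1) + p"]) (auto simp: prod_eq_iff)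
  qed
  also have "?X = quadrant \<union> (\<lambda>p. (int j, -1) + p) ` quadrant"
  proof (intro Set.set_eqI iffI)
    fix p :: "int \<times> int" assume p: "p \<in> ?X"
    show "p \<in> quadrant \<union> (\<lambda>p. (int j, -1) + p) ` quadrant"
    proof (cases "p \<in> quadrant")
      case False
      then have "p \<in> (\<lambda>p. (int j, -1) + p) ` quadrant" using p
        by (intro image_eqI[of _ _ "(- int j, 1) + p"]) (auto simp: prod_eq_iff quadrant_def)
      then show ?thesis by blast
    qed blast
  qed (auto simp: quadrant_def)
  finally show ?thesis .
qed

definition partial_sum :: "(nat \<Rightarrow> nat) \<Rightarrow> nat \<Rightarrow> (int \<times> int) set" where
  "partial_sum a n = finprod submodule_monoid (\<lambda>j. F j [^]\<^bsub>submodule_monoid\<^esub> a j) {1..n}"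

definition \<eta> :: "(nat \<Rightarrow> nat) \<Rightarrow> (int \<times> int) set" where
  "\<eta> a = (THE L. limitin \<A>_topology (partial_sum a) L sequentially)"


section \<open>Multiplicities\<close>

definition truncation :: "(int \<times> int) set \<Rightarrow> nat \<Rightarrow> (int \<times> int) set" where
  "truncation M c = {(a, b) \<in> M. - int c \<le> b}"

definition no_flat_segment :: "nat \<Rightarrow> (int \<times> int) set \<Rightarrow> bool" where
  "no_flat_segment n L \<longleftrightarrow>
     (\<nexists>S k. finite_facet S (New L) \<and> n < k \<and> outward_normal (New L) S (-1, - real k))"

definition \<rho> :: "nat \<Rightarrow> (int \<times> int) set \<Rightarrow> (int \<times> int) set" where
  "\<rho> n M =
     (let admissible = (\<lambda>c. no_flat_segment n (truncation M c)) in
      if \<exists>c. admissible c \<and> (\<forall>c'. admissible c' \<longrightarrow> c' \<le> c)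
      then truncation M (GREATEST c. admissible c) else M)"

text \<open>\<open>w_at M n j\<close> is the coefficient of \<open>F j\<close> in the expression of \<open>\<rho> n M\<close> as a sum of
  \<open>F 1, \<dots>, F n\<close>, and \<open>w M j\<close> is its common value for all \<open>n \<ge> j\<close>.\<close>

definition w_at :: "(int \<times> int) set \<Rightarrow> nat \<Rightarrow> nat \<Rightarrow> nat" where
  "w_at M n = (THE u. u \<in> {1..n} \<rightarrow>\<^sub>E UNIV \<and> \<rho> n M = partial_sum u n)"

definition w :: "(int \<times> int) set \<Rightarrow> nat \<Rightarrow> nat" where
  "w M j = (THE v. \<forall>n\<ge>j. w_at M n j = v)"

end

theory Submission
  imports Defs
begin

text \<open>
  The boundary of a member of \<open>\<A>\<close> starts at the origin and descends to the right along edges of slopes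
  \<open>- 1 / j\<close>, in order of increasing \<open>j\<close>.  If the edge of slope \<open>- 1 / j\<close> drops by \<open>a j\<close>, the whole
  set is determined by the sequence \<open>a\<close>, and Minkowski addition merges the edges, hence adds the
  sequences.  The generator \<open>F j\<close> has a single edge, which drops by \<open>1\<close>.  So the theorem says
  that every sequence occurs and that nothing else does.

  The proof works on the dual side.  With \<open>depth a t = a 1 + \<dots> + a t\<close>, the set belonging to \<open>a\<close>
  consists of the lattice points \<open>(x, y)\<close> such that
  \<open>0 \<le> x + (\<Sum>j<t. depth a j + y)\<close> for all \<open>t\<close>; it is called \<open>staircase a\<close>.  The constraint \<open>t\<close> bounds
  the functional \<open>x + t y\<close>, whose minimum on a set is additive under Minkowski sums.  This makes
  \<open>staircase (a + b) = staircase a + staircase b\<close> (lemma \<open>staircase_sum\<close>) and turns partial sums of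
  the \<open>F j\<close> into staircases of truncated sequences.

  For a fixed height \<open>y\<close> only one constraint is binding, which gives the Newton polyhedron of a
  staircase and its facets (\<open>New_staircase\<close>, \<open>facet_of_region_cases\<close>), and thereby membership in
  \<open>\<A>\<close> (\<open>staircase_in_A\<close>).  Conversely, let \<open>L\<close> be in \<open>\<A>\<close>.  Having no ray of negative slope,
  \<open>L\<close> has a minimum of \<open>x + t y\<close> for each \<open>t\<close>; because finite facets have integral slope parameter,
  the functionals for \<open>t\<close> and \<open>t + 1\<close> have a common minimiser (\<open>consecutive_minimiser\<close>).  These
  minimisers are the vertices of a staircase, and \<open>L\<close> is that staircase (\<open>A_imp_staircase\<close>).

  Whether \<open>(x, y)\<close> belongs to \<open>staircase a\<close> depends only on the \<open>a j\<close> with \<open>j \<le> x\<close>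
  (\<open>staircase_local\<close>), and \<open>a 1, \<dots>, a n\<close> can be read off from finitely many lattice points
  (\<open>eq_if_vertices_agree\<close>).  The first fact gives continuity and the convergence of the partial sums, the second injectivity
  and the continuity of the inverse.  Finally, truncating a staircase at depth \<open>c\<close> keeps the
  \<open>c\<close> smallest indices of \<open>a\<close>, so \<open>\<rho> n\<close> keeps exactly the indices up to \<open>n\<close>, and the
  multiplicities are the \<open>a j\<close> (\<open>rho_staircase\<close>, \<open>w_staircase\<close>).
\<close>

section \<open>Staircases and their addition\<close>

text \<open>\<open>depth a t\<close> is the total drop of the boundary along the edges of slope \<open>- 1 / j\<close> with \<open>1 \<le> j \<le> t\<close>;
  sequences enter below only through it, so those that agree on the positive integers give the same sets.\<close>
definition depth :: "(nat \<Rightarrow> nat) \<Rightarrow> nat \<Rightarrow> int" where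
  "depth a t = (\<Sum>i = 1..t. int (a i))"

text \<open>The polyhedron cut out by the half planes \<open>0 \<le> x + t y + (depth a 0 + \<dots> + depth a (t - 1))\<close>, one
  for each outward normal \<open>(-1, -t)\<close>.  Writing the bound as a sum of the increments \<open>depth a j + y\<close>,
  whose signs change from negative to nonnegative once, makes it visible which half plane is the
  binding one at a given height \<open>y\<close>.\<close>
definition region :: "(nat \<Rightarrow> nat) \<Rightarrow> (real \<times> real) set" where
  "region a = {(x, y). \<forall>t. 0 \<le> x + (\<Sum>j<t. real_of_int (depth a j) + y)}"

definition staircase :: "(nat \<Rightarrow> nat) \<Rightarrow> (int \<times> int) set" where
  "staircase a = {p. real_point p \<in> region a}"

text \<open>The common endpoint of the edges of slopes \<open>- 1 / t\<close> and \<open>- 1 / (t + 1)\<close>, either of which may be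
  degenerate; the vertex with index \<open>0\<close> is the origin.\<close>
definition vertex :: "(nat \<Rightarrow> nat) \<Rightarrow> nat \<Rightarrow> int \<times> int" where
  "vertex a t = (\<Sum>j<t. depth a t - depth a j, - depth a t)"

lemma depth_0 [simp]: "depth a 0 = 0"
  by (simp add: depth_def)

lemma depth_Suc [simp]: "depth a (Suc t) = depth a t + int (a (Suc t))"
  by (simp add: depth_def)

lemma depth_mono: "s \<le> t \<Longrightarrow> depth a s \<le> depth a t"
  by (rule lift_Suc_mono_le[of "depth a"]) auto

lemma depth_nonneg [simp]: "0 \<le> depth a t"
  using depth_mono[of 0 t a] by simp

lemma depth_cong: "(\<And>j. 1 \<le> j \<Longrightarrow> j \<le> t \<Longrightarrow> a j = b j) \<Longrightarrow> depth a t = depth b t"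
  unfolding depth_def by (rule sum.cong) auto

lemma depth_add: "depth (\<lambda>j. a j + b j) t = depth a t + depth b t"
  by (simp add: depth_def sum.distrib)

text \<open>Differences recover a sequence from its depths; the truncation \<open>nat\<close> is harmless because the
  depths increase.\<close>
lemma depth_surj:
  fixes N :: "nat \<Rightarrow> int"
  assumes "N 0 = 0" and "\<And>t. N t \<le> N (Suc t)"
  shows "depth (\<lambda>j. nat (N j - N (j - 1))) = N"
proof
  fix t show "depth (\<lambda>j. nat (N j - N (j - 1))) t = N t"
    by (induction t) (use assms in auto)
qed

lemma staircase_iff: "(x, y) \<in> staircase a \<longleftrightarrow> (\<forall>t. 0 \<le> x + (\<Sum>j<t. depth a j + y))"
proof -
  have "real_of_int x + (\<Sum>j<t. real_of_int (depth a j) + real_of_int y)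
      = real_of_int (x + (\<Sum>j<t. depth a j + y))" for t
    by simp
  then show ?thesis
    unfolding staircase_def region_def real_point_def by (simp del: of_int_add of_int_sum)
qed

lemma staircase_cong: "(\<And>j. 1 \<le> j \<Longrightarrow> a j = b j) \<Longrightarrow> staircase a = staircase b"
  unfolding staircase_def region_def using depth_cong[of _ a b] by simp

text \<open>Partial sums of terms that are first nonpositive and then nonnegative are least at the change
  of sign.  Hence at height \<open>y\<close> the half plane with index \<open>s\<close>, where \<open>depth a\<close> passes \<open>- y\<close>, implies all
  the others.\<close>
lemma crossing_minimises:
  fixes N :: "nat \<Rightarrow> 'a :: linordered_idom"
  assumes "\<And>j. j < s \<Longrightarrow> N j + y \<le> 0" "\<And>j. s \<le> j \<Longrightarrow> 0 \<le> N j + y"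
  shows "(\<Sum>j<s. N j + y) \<le> (\<Sum>j<t. N j + y)"
proof (cases "s \<le> t")
  case True
  then show ?thesis by (intro sum_mono2) (auto intro: assms)
next
  case False
  then have "(\<Sum>j<t. - (N j + y)) \<le> (\<Sum>j<s. - (N j + y))"
    by (intro sum_mono2) (auto simp del: minus_add_distrib intro: assms)
  then show ?thesis unfolding sum_negf by simp
qed

text \<open>If the depths never reached \<open>- y\<close>, the increments would stay below a fixed negative number,
  since depths are integers, and the bounds on \<open>x\<close> would grow without limit.\<close>
lemma region_bounds:
  assumes "(x, y) \<in> region a"
  shows "0 \<le> x" "\<exists>t. 0 \<le> real_of_int (depth a t) + y"
proof -
  have le: "0 \<le> x + (\<Sum>j<t. real_of_int (depth a j) + y)" for t
    using assms by (auto simp: region_def)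
  from le[of 0] show "0 \<le> x" by simp
  show "\<exists>t. 0 \<le> real_of_int (depth a t) + y"
  proof (rule ccontr)
    assume "\<not> ?thesis"
    then have neg: "\<not> 0 \<le> real_of_int (depth a t) + y" for t by blast
    have lt: "real_of_int (depth a t) < - y" for t using neg[of t] by linarith
    define e where "e = - y - real_of_int (\<lceil>- y\<rceil> - 1)"
    have "depth a t \<le> \<lceil>- y\<rceil> - 1" for t using lt[of t] by linarith
    then have "real_of_int (depth a t) \<le> real_of_int (\<lceil>- y\<rceil> - 1)" for t
      unfolding of_int_le_iff .
    then have "real_of_int (depth a t) + y \<le> - e" for t
      unfolding e_def by (simp add: algebra_simps)
    then have ub: "(\<Sum>j<t. real_of_int (depth a j) + y) \<le> - (real t * e)" for t
      using sum_bounded_above[of "{..<t}" "\<lambda>j. real_of_int (depth a j) + y" "- e"] by simp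
    have "real t * e \<le> x" for t using le[of t] ub[of t] by linarith
    moreover have "0 < e" unfolding e_def by linarith
    ultimately show False using reals_Archimedean3[of e] by (metis not_le)
  qed
qed

lemma region_crossing:
  assumes "(x, y) \<in> region a" "y < 0"
  obtains s where "1 \<le> s" "real_of_int (depth a (s - 1)) + y < 0"
    "0 \<le> real_of_int (depth a s) + y"
    "\<And>j. j < s \<Longrightarrow> real_of_int (depth a j) + y \<le> 0" "\<And>j. s \<le> j \<Longrightarrow> 0 \<le> real_of_int (depth a j) + y"
proof -
  define s where "s = (LEAST t. 0 \<le> real_of_int (depth a t) + y)"
  have s: "0 \<le> real_of_int (depth a s) + y"
    unfolding s_def by (rule LeastI_ex) (use region_bounds(2)[OF assms(1)] in blast)
  have lt: "real_of_int (depth a j) + y < 0" if "j < s" for j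
    using not_less_Least[OF that[unfolded s_def]] by simp
  have "s \<noteq> 0" using s assms(2) by (metis add_0 depth_0 not_le of_int_0)
  moreover have "0 \<le> real_of_int (depth a j) + y" if "s \<le> j" for j
    using s depth_mono[OF that, of a] by linarith
  ultimately show thesis using that[of s] lt s by (simp add: less_imp_le)
qed

lemma staircase_crossing:
  assumes "(x, y) \<in> staircase a" "y < 0"
  obtains s where "1 \<le> s" "depth a (s - 1) + y < 0" "0 \<le> depth a s + y"
    "\<And>j. j < s \<Longrightarrow> depth a j + y \<le> 0" "\<And>j. s \<le> j \<Longrightarrow> 0 \<le> depth a j + y"
proof -
  have "(real_of_int x, real_of_int y) \<in> region a" "real_of_int y < 0"
    using assms by (simp_all add: staircase_def real_point_def)
  from region_crossing[OF this] obtain s where s: "1 \<le> s"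
    "real_of_int (depth a (s - 1)) + real_of_int y < 0"
    "0 \<le> real_of_int (depth a s) + real_of_int y"
    "\<And>j. j < s \<Longrightarrow> real_of_int (depth a j) + real_of_int y \<le> 0"
    "\<And>j. s \<le> j \<Longrightarrow> 0 \<le> real_of_int (depth a j) + real_of_int y" by blast
  show thesis
  proof (rule that[OF s(1)])
    show "depth a (s - 1) + y < 0" "0 \<le> depth a s + y" using s(2,3) by linarith+
    show "depth a j + y \<le> 0" if "j < s" for j using s(4)[OF that] by linarith
    show "0 \<le> depth a j + y" if "s \<le> j" for j using s(5)[OF that] by linarith
  qed
qed

lemma staircase_bounds:
  assumes "(x, y) \<in> staircase a"
  shows "0 \<le> x" "\<exists>t. 0 \<le> depth a t + y"
proof -
  show "0 \<le> x" using assms[unfolded staircase_iff, rule_format, of 0] by simp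
  show "\<exists>t. 0 \<le> depth a t + y"
  proof (cases "y < 0")
    case True
    with assms obtain s where "0 \<le> depth a s + y" by (rule staircase_crossing)
    then show ?thesis by blast
  next
    case False then show ?thesis by (intro exI[of _ 0]) simp
  qed
qed

lemma quadrant_subset_staircase: "quadrant \<subseteq> staircase a"
proof
  fix p assume "p \<in> quadrant"
  then obtain x y where p: "p = (x, y)" "0 \<le> x" "0 \<le> y" by (auto simp: quadrant_def)
  have "0 \<le> x + (\<Sum>j<t. depth a j + y)" for t
    using p by (intro add_nonneg_nonneg sum_nonneg) simp_all
  then show "p \<in> staircase a" by (simp add: p staircase_iff)
qed

lemma staircase_at_crossing:
  assumes "\<And>j. j < s \<Longrightarrow> depth a j + y \<le> 0" "\<And>j. s \<le> j \<Longrightarrow> 0 \<le> depth a j + y"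
  shows "(x, y) \<in> staircase a \<longleftrightarrow> 0 \<le> x + (\<Sum>j<s. depth a j + y)"
proof
  assume *: "0 \<le> x + (\<Sum>j<s. depth a j + y)"
  have "0 \<le> x + (\<Sum>j<t. depth a j + y)" for t
    using * crossing_minimises[of s "depth a" y t, OF assms] by linarith
  then show "(x, y) \<in> staircase a" by (simp add: staircase_iff)
qed (simp add: staircase_iff)

text \<open>The half plane bounds add, which gives one inclusion.  Conversely a point at depth \<open>c\<close> splits
  because \<open>c\<close> can be written as \<open>c' + c''\<close> with both parts crossing at the same index \<open>s\<close>, and then
  the binding constraints of the two summands add up to the binding constraint of the sum.\<close>
lemma staircase_sum: "staircase a + staircase b = staircase (\<lambda>j. a j + b j)"
proof (intro subset_antisym subsetI)
  fix p assume "p \<in> staircase a + staircase b"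
  then obtain q r where p: "p = q + r" and qr: "q \<in> staircase a" "r \<in> staircase b"
    by (auto elim: set_plus_elim)
  obtain x y x' y' where q: "q = (x, y)" and r: "r = (x', y')" by fastforce
  have "0 \<le> x + x' + (\<Sum>j<t. depth a j + depth b j + (y + y'))" for t
  proof -
    have "0 \<le> (x + (\<Sum>j<t. depth a j + y)) + (x' + (\<Sum>j<t. depth b j + y'))"
      using qr unfolding q r staircase_iff by (metis add_nonneg_nonneg)
    then show ?thesis by (simp add: sum.distrib algebra_simps)
  qed
  then show "p \<in> staircase (\<lambda>j. a j + b j)"
    by (simp add: p q r staircase_iff depth_add)
next
  fix p assume p: "p \<in> staircase (\<lambda>j. a j + b j)"
  obtain x y where xy: "p = (x, y)" by fastforce
  have mem: "(x, y) \<in> staircase (\<lambda>j. a j + b j)" using p xy by simp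
  show "p \<in> staircase a + staircase b"
  proof (cases "y < 0")
    case False
    then have "p \<in> staircase a"
      using quadrant_subset_staircase[of a] staircase_bounds(1)[OF mem]
      by (auto simp: quadrant_def xy)
    moreover have "(0, 0) \<in> staircase b"
      using quadrant_subset_staircase[of b] by (auto simp: quadrant_def)
    ultimately have "p + (0, 0) \<in> staircase a + staircase b" by (rule set_plus_intro)
    then show ?thesis by (simp add: xy)
  next
    case True
    from staircase_crossing[OF mem True] obtain s where s: "1 \<le> s"
      "depth a (s - 1) + depth b (s - 1) + y < 0" "0 \<le> depth a s + depth b s + y"
      by (metis depth_add)
    \<comment> \<open>The part of the depth given to \<open>a\<close> must lie between \<open>depth a (s - 1)\<close> and \<open>depth a s\<close> and leave
      at most \<open>depth b s\<close>; the least such value also leaves at least \<open>depth b (s - 1)\<close>.\<close>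
    define u where "u = - max (depth a (s - 1)) (- y - depth b s)"
    have u: "depth a (s - 1) + u \<le> 0" "0 \<le> depth a s + u"
      "depth b (s - 1) + (y - u) \<le> 0" "0 \<le> depth b s + (y - u)"
      using s depth_mono[of "s - 1" s a] depth_mono[of "s - 1" s b] by (auto simp: u_def)
    have *: "(\<forall>j<s. depth c j + v \<le> 0) \<and> (\<forall>j\<ge>s. 0 \<le> depth c j + v)"
      if "depth c (s - 1) + v \<le> 0" "0 \<le> depth c s + v" for c v
    proof (intro conjI allI impI)
      fix j assume "j < s"
      then show "depth c j + v \<le> 0" using that(1) depth_mono[of j "s - 1" c] by linarith
    next
      fix j assume "s \<le> j"
      then show "0 \<le> depth c j + v" using that(2) depth_mono[of s j c] by simp
    qed
    define x' where "x' = - (\<Sum>j<s. depth a j + u)"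
    have "(x', u) \<in> staircase a"
      using *[OF u(1,2)] by (subst staircase_at_crossing[of s]) (simp_all add: x'_def)
    moreover have "(x - x', y - u) \<in> staircase b"
    proof -
      have "0 \<le> x + (\<Sum>j<s. depth a j + depth b j + y)"
        using mem by (simp add: staircase_iff depth_add)
      then have "0 \<le> x - x' + (\<Sum>j<s. depth b j + (y - u))"
        by (simp add: x'_def sum.distrib sum_subtractf algebra_simps)
      then show ?thesis using *[OF u(3,4)] by (subst staircase_at_crossing[of s]) simp_all
    qed
    ultimately have "(x', u) + (x - x', y - u) \<in> staircase a + staircase b" by (rule set_plus_intro)
    then show ?thesis by (simp add: xy)
  qed
qed

lemma quadrant_eq_staircase: "quadrant = staircase (\<lambda>_. 0)"
proof (intro subset_antisym quadrant_subset_staircase subsetI)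
  fix p assume p: "p \<in> staircase (\<lambda>_. 0)"
  obtain x y where xy: "p = (x, y)" by fastforce
  have "depth (\<lambda>_. 0) t = 0" for t by (simp add: depth_def)
  then show "p \<in> quadrant"
    using staircase_bounds[of x y "\<lambda>_. 0"] p by (simp add: quadrant_def xy)
qed

lemma F_eq_staircase:
  assumes "1 \<le> j"
  shows "F j = staircase (\<lambda>i. if i = j then 1 else 0)"
proof -
  let ?e = "\<lambda>i. if i = j then 1 else 0 :: nat"
  have d: "depth ?e t = (if j \<le> t then 1 else 0)" for t
    by (induction t) (use assms in auto)
  have Fj: "(x, y) \<in> F j \<longleftrightarrow> 0 \<le> x \<and> -1 \<le> y \<and> (int j \<le> x \<or> 0 \<le> y)" for x y
  proof -
    have "(x, y) \<in> (\<lambda>p. (int j, -1) + p) ` quadrant \<longleftrightarrow> int j \<le> x \<and> -1 \<le> y"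
    proof
      assume "int j \<le> x \<and> -1 \<le> y"
      then show "(x, y) \<in> (\<lambda>p. (int j, -1) + p) ` quadrant"
        by (intro image_eqI[of _ _ "(x - int j, y + 1)"]) (auto simp: quadrant_def)
    qed (auto simp: quadrant_def)
    then show ?thesis unfolding F_eq by (auto simp: quadrant_def)
  qed
  have "(x, y) \<in> F j \<longleftrightarrow> (x, y) \<in> staircase ?e" for x y
  proof (cases "y = -1")
    case True
    have "(x, y) \<in> staircase ?e \<longleftrightarrow> 0 \<le> x + (\<Sum>i<j. depth ?e i + y)"
      by (rule staircase_at_crossing) (auto simp: d True)
    also have "(\<Sum>i<j. depth ?e i + y) = - int j" by (simp add: d True)
    finally show ?thesis by (auto simp: Fj True)
  next
    case False
    have "(x, y) \<in> staircase ?e \<longleftrightarrow> 0 \<le> x \<and> 0 \<le> y"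
    proof
      assume *: "(x, y) \<in> staircase ?e"
      from staircase_bounds(2)[OF *] have "-1 \<le> y" by (auto simp: d split: if_splits)
      then show "0 \<le> x \<and> 0 \<le> y" using False staircase_bounds(1)[OF *] by auto
    qed (use quadrant_subset_staircase in \<open>auto simp: quadrant_def\<close>)
    then show ?thesis using False by (auto simp: Fj)
  qed
  then show ?thesis by auto
qed

lemma vertex_in_staircase: "vertex a t \<in> staircase a"
proof -
  have "0 \<le> (\<Sum>j<t. depth a t - depth a j) + (\<Sum>j<t. depth a j + - depth a t)"
    unfolding sum.distrib[symmetric] by simp
  then show ?thesis
    unfolding vertex_def by (subst staircase_at_crossing[of t]) (simp_all add: depth_mono)
qed

section \<open>The Newton polyhedron of a staircase\<close>

text \<open>The minimum of \<open>x + t y\<close> on the region is \<open>- support a t\<close>; it is attained at both endpoints of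
  the edge with index \<open>t\<close>.\<close>
definition support :: "(nat \<Rightarrow> nat) \<Rightarrow> nat \<Rightarrow> int" where
  "support a t = (\<Sum>j<t. depth a j)"

definition slack :: "(nat \<Rightarrow> nat) \<Rightarrow> nat \<Rightarrow> real \<times> real \<Rightarrow> real" where
  "slack a t p = fst p + real t * snd p + real_of_int (support a t)"

definition edge :: "(nat \<Rightarrow> nat) \<Rightarrow> nat \<Rightarrow> (real \<times> real) set" where
  "edge a t = closed_segment (real_point (vertex a (t - 1))) (real_point (vertex a t))"

lemma support_0 [simp]: "support a 0 = 0" and support_Suc [simp]: "support a (Suc t) = support a t + depth a t"
  by (simp_all add: support_def)

lemma slack_Suc: "slack a (Suc t) p = slack a t p + (snd p + real_of_int (depth a t))"
  by (simp add: slack_def algebra_simps)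

lemma slack_eq_sum: "slack a t (x, y) = x + (\<Sum>j<t. real_of_int (depth a j) + y)"
  by (simp add: slack_def support_def sum.distrib)

lemma region_iff: "p \<in> region a \<longleftrightarrow> (\<forall>t. 0 \<le> slack a t p)"
  by (cases p) (simp add: region_def slack_eq_sum)

lemma staircase_iff_support: "(x, y) \<in> staircase a \<longleftrightarrow> (\<forall>t. 0 \<le> x + int t * y + support a t)"
  by (simp add: staircase_iff support_def sum.distrib algebra_simps)

lemma vertex_eq: "vertex a t = (int t * depth a t - support a t, - depth a t)"
  by (simp add: vertex_def support_def sum_subtractf)

lemma slack_vertex [simp]: "slack a t (real_point (vertex a t)) = 0"
  "slack a (Suc t) (real_point (vertex a t)) = 0"
  by (simp_all add: slack_def vertex_eq real_point_def algebra_simps)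

lemma eq_vertex_iff:
  "p = real_point (vertex a t) \<longleftrightarrow> slack a t p = 0 \<and> slack a (Suc t) p = 0"
proof
  assume *: "slack a t p = 0 \<and> slack a (Suc t) p = 0"
  then have "snd p = - real_of_int (depth a t)" by (simp add: slack_Suc)
  moreover from this * have "fst p = real t * real_of_int (depth a t) - real_of_int (support a t)"
    by (simp add: slack_def)
  ultimately show "p = real_point (vertex a t)"
    by (simp add: vertex_eq real_point_def prod_eq_iff)
qed auto

lemma real_vertex_in_region: "real_point (vertex a t) \<in> region a"
  using vertex_in_staircase by (simp add: staircase_def)

lemma slack_eq_inner: "slack a t p = (1, real t) \<bullet> p + real_of_int (support a t)"
  by (simp add: slack_def inner_prod_def)

lemma slack_nonneg_iff: "0 \<le> slack a t p \<longleftrightarrow> - real_of_int (support a t) \<le> (1, real t) \<bullet> p"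
  unfolding slack_eq_inner by linarith

lemma region_eq_Inter: "region a = (\<Inter>t. {p. (1, real t) \<bullet> p \<ge> - real_of_int (support a t)})"
  by (auto simp: region_iff slack_nonneg_iff)

lemma convex_region: "convex (region a)"
  unfolding region_eq_Inter by (intro convex_INT convex_halfspace_ge)

lemma submodule_mono:
  assumes "monoid_submodule L" "(x, y) \<in> L" "x \<le> x'" "y \<le> y'"
  shows "(x', y') \<in> L"
proof -
  have "(x, y) + (x' - x, y' - y) \<in> L + quadrant"
    using assms by (intro set_plus_intro) (auto simp: quadrant_def)
  then show ?thesis using assms(1) by (auto simp: monoid_submodule_def)
qed

text \<open>Moving by a real vector of the quadrant stays inside the convex hull, although a submodule is
  closed under integer steps only: a lattice point moved by \<open>(u, v)\<close> lies in the triangle spanned by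
  that point and its translates by \<open>(n, 0)\<close> and \<open>(0, n)\<close> once \<open>u + v \<le> n\<close>.\<close>
lemma New_mono:
  assumes L: "monoid_submodule L" and p: "p \<in> New L" and "0 \<le> u" "0 \<le> v"
  shows "p + (u, v) \<in> New L"
proof -
  obtain n :: nat where n: "u + v + 1 \<le> real n" using real_arch_simple by blast
  have n0: "0 < real n" using n assms by linarith
  define \<alpha> \<beta> where "\<alpha> = u / real n" and "\<beta> = v / real n"
  have n\<alpha>: "\<alpha> * real n = u" and n\<beta>: "\<beta> * real n = v" using n0 by (simp_all add: \<alpha>_def \<beta>_def)
  have "\<alpha> + \<beta> \<le> 1" using n n0 by (simp add: \<alpha>_def \<beta>_def add_divide_distrib[symmetric])
  moreover have "0 \<le> \<alpha>" "0 \<le> \<beta>" using assms by (simp_all add: \<alpha>_def \<beta>_def)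
  ultimately have \<alpha>\<beta>: "0 \<le> 1 - \<alpha> - \<beta>" "0 \<le> \<alpha>" "0 \<le> \<beta>" "1 - \<alpha> - \<beta> + \<alpha> + \<beta> = 1" by simp_all
  have "real_point ` L \<subseteq> {q. q + (u, v) \<in> New L}"
  proof
    fix q assume "q \<in> real_point ` L"
    then obtain x y where xy: "(x, y) \<in> L" and q: "q = real_point (x, y)" by auto
    let ?T = "{real_point (x, y), real_point (x + int n, y), real_point (x, y + int n)}"
    have "q + (u, v) = (1 - \<alpha> - \<beta>) *\<^sub>R real_point (x, y)
        + \<alpha> *\<^sub>R real_point (x + int n, y) + \<beta> *\<^sub>R real_point (x, y + int n)"
      unfolding q real_point_def by (simp add: n\<alpha>[symmetric] n\<beta>[symmetric] algebra_simps)
    then have "q + (u, v) \<in> convex hull ?T"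
      unfolding convex_hull_3 using \<alpha>\<beta> by blast
    moreover have "?T \<subseteq> real_point ` L"
      using submodule_mono[OF L xy] xy by simp
    ultimately show "q \<in> {q. q + (u, v) \<in> New L}"
      unfolding New_def using hull_mono by blast
  qed
  moreover have "convex {q. q + (u, v) \<in> New L}"
  proof (rule convexI)
    fix q r :: "real \<times> real" and s t :: real
    assume qr: "q \<in> {q. q + (u, v) \<in> New L}" "r \<in> {q. q + (u, v) \<in> New L}" and st: "0 \<le> s" "0 \<le> t" "s + t = 1"
    have "s *\<^sub>R (q + c) + t *\<^sub>R (r + c) = s *\<^sub>R q + t *\<^sub>R r + (s + t) *\<^sub>R c" for c
      by (simp add: scaleR_add_left scaleR_add_right)
    then have "s *\<^sub>R q + t *\<^sub>R r + (u, v) = s *\<^sub>R (q + (u, v)) + t *\<^sub>R (r + (u, v))"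
      unfolding st(3) scaleR_one by (rule sym)
    then show "s *\<^sub>R q + t *\<^sub>R r \<in> {q. q + (u, v) \<in> New L}"
      using convexD[OF convex_convex_hull _ _ st] qr unfolding New_def by simp
  qed
  ultimately have "New L \<subseteq> {q. q + (u, v) \<in> New L}"
    unfolding New_def[of L] by (rule hull_minimal)
  then show ?thesis using p by auto
qed

lemma real_point_in_New: "p \<in> L \<Longrightarrow> real_point p \<in> New L"
  by (simp add: New_def hull_inc)

lemma convex_New: "convex (New L)"
  by (simp add: New_def convex_convex_hull)

lemma submodule_staircase: "monoid_submodule (staircase a)"
  unfolding monoid_submodule_def quadrant_eq_staircase staircase_sum by simp

text \<open>Tightness at \<open>t\<close> together with the constraints \<open>t - 1\<close> and \<open>t + 1\<close> confines the depth to the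
  interval from \<open>depth a (t - 1)\<close> to \<open>depth a t\<close>.\<close>
lemma edge_eq:
  assumes "1 \<le> t"
  shows "{p \<in> region a. slack a t p = 0} = edge a t"
proof (intro subset_antisym subsetI)
  have s: "slack a t (real_point (vertex a (t - 1))) = 0"
    using slack_vertex(2)[of a "t - 1"] assms by simp
  have "convex ({p. (1, real t) \<bullet> p = - real_of_int (support a t)})" by (rule convex_hyperplane)
  then have cvx: "convex {p \<in> region a. slack a t p = 0}"
    using convex_Int[OF convex_region[of a]]
    by (simp add: slack_eq_inner Collect_conj_eq eq_neg_iff_add_eq_0)
  fix p assume p: "p \<in> edge a t"
  have "edge a t \<subseteq> {p \<in> region a. slack a t p = 0}"
    using s unfolding edge_def by (intro closed_segment_subset cvx) (simp_all add: real_vertex_in_region)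
  then show "p \<in> {p \<in> region a. slack a t p = 0}" using p by blast
next
  fix p assume p: "p \<in> {p \<in> region a. slack a t p = 0}"
  obtain r where r: "t = Suc r" using assms by (cases t) auto
  let ?y = "snd p"
  have "0 \<le> slack a r p" "0 \<le> slack a (Suc t) p" using p by (simp_all add: region_iff)
  then have y: "real_of_int (depth a r) \<le> - ?y" "- ?y \<le> real_of_int (depth a t)"
    using p slack_Suc[of a r p] slack_Suc[of a t p] by (simp_all add: r)
  have x: "fst p = - real t * ?y - real_of_int (support a t)" using p by (simp add: slack_def)
  show "p \<in> edge a t"
  proof (cases "a t = 0")
    case True
    then have "?y = - real_of_int (depth a t)" using y by (simp add: r)
    with x have "p = real_point (vertex a t)"
      by (simp add: vertex_eq real_point_def prod_eq_iff)
    then show ?thesis by (simp add: edge_def)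
  next
    case False
    define u where "u = (- ?y - real_of_int (depth a r)) / real (a t)"
    have u: "u * real (a t) = - ?y - real_of_int (depth a r)" using False by (simp add: u_def)
    have "0 \<le> u" "u \<le> 1" using y False by (auto simp: u_def r field_simps)
    moreover have "p = (1 - u) *\<^sub>R real_point (vertex a r) + u *\<^sub>R real_point (vertex a t)"
    proof -
      have y': "?y = - real_of_int (depth a r) - u * real (a (Suc r))" using u by (simp add: r)
      show ?thesis
        by (simp add: x y' vertex_eq real_point_def prod_eq_iff r algebra_simps)
    qed
    ultimately show ?thesis unfolding edge_def in_segment by (auto simp: r)
  qed
qed

text \<open>At every height the leftmost point of the region lies on an edge, whose endpoints are vertices;
  the remaining points are reached by moving to the right.  The hypothesis concerns only the vertices,
  so that the inclusion also serves to recognise an abstract member of \<open>\<A>\<close> as a staircase.\<close>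
lemma region_subset_New:
  assumes L: "monoid_submodule L" and vertices: "\<And>t. vertex a t \<in> L"
  shows "region a \<subseteq> New L"
proof
  fix p assume p: "p \<in> region a"
  obtain x y where xy: "p = (x, y)" by fastforce
  have x0: "0 \<le> x" using region_bounds(1) p xy by blast
  note up = New_mono[OF L]
  show "p \<in> New L"
  proof (cases "y < 0")
    case False
    have "real_point (vertex a 0) \<in> New L" using vertices by (rule real_point_in_New)
    from up[OF this x0, of y] show ?thesis using False by (simp add: xy real_point_def vertex_eq)
  next
    case True
    from p have "(x, y) \<in> region a" by (simp add: xy)
    then obtain s where s: "1 \<le> s"
      "\<And>j. j < s \<Longrightarrow> real_of_int (depth a j) + y \<le> 0" "\<And>j. s \<le> j \<Longrightarrow> 0 \<le> real_of_int (depth a j) + y"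
      using True by (rule region_crossing) blast
    \<comment> \<open>the leftmost point at height \<open>y\<close>, where the constraint \<open>s\<close> is tight\<close>
    define x' where "x' = - (\<Sum>j<s. real_of_int (depth a j) + y)"
    have "0 \<le> x' + (\<Sum>j<t. real_of_int (depth a j) + y)" for t
      using crossing_minimises[of s "\<lambda>j. real_of_int (depth a j)" y t, OF s(2,3)] by (simp add: x'_def)
    then have "(x', y) \<in> {p \<in> region a. slack a s p = 0}"
      by (simp add: region_def slack_eq_sum x'_def)
    then have "(x', y) \<in> edge a s" by (simp add: edge_eq[OF s(1)])
    moreover have "edge a s \<subseteq> New L"
      unfolding edge_def by (intro closed_segment_subset convex_New real_point_in_New vertices)
    ultimately have "(x', y) \<in> New L" by blast
    moreover have "x' \<le> x"
    proof -
      have "0 \<le> x + (\<Sum>j<s. real_of_int (depth a j) + y)" using p by (simp add: xy region_def)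
      then show ?thesis unfolding x'_def by linarith
    qed
    ultimately show ?thesis using up[of "(x', y)" "x - x'" 0] by (simp add: xy)
  qed
qed

lemma New_staircase: "New (staircase a) = region a"
proof (rule subset_antisym)
  show "New (staircase a) \<subseteq> region a"
    unfolding New_def by (rule hull_minimal) (auto simp: staircase_def convex_region)
  show "region a \<subseteq> New (staircase a)"
    by (intro region_subset_New submodule_staircase vertex_in_staircase)
qed

text \<open>A face need not be exposed, but a facet is: a supporting hyperplane through a point of its
  relative interior cuts out a proper face that contains the facet, and for dimension reasons the two
  coincide.\<close>
lemma facet_exposed:
  fixes P :: "'a::euclidean_space set"
  assumes "convex P" "S facet_of P"
  obtains v s where "v \<noteq> 0" "\<And>x. x \<in> P \<Longrightarrow> s \<le> v \<bullet> x" "S = {x \<in> P. v \<bullet> x = s}"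
proof -
  have S: "S face_of P" "S \<noteq> {}" "aff_dim S = aff_dim P - 1" using assms(2) by (auto simp: facet_of_def)
  have "S \<noteq> P" using S(3) by auto
  have "convex S" using S(1) face_of_imp_convex by blast
  then obtain p where p: "p \<in> rel_interior S" using S(2) rel_interior_eq_empty by blast
  then have "p \<in> S" using rel_interior_subset by blast
  then have "p \<in> P" using S(1) face_of_imp_subset by blast
  have "p \<notin> rel_interior P"
    using face_of_disjoint_rel_interior[OF S(1) \<open>S \<noteq> P\<close>] \<open>p \<in> S\<close> by blast
  then obtain v where v: "v \<noteq> 0" "\<And>y. y \<in> P \<Longrightarrow> v \<bullet> p \<le> v \<bullet> y"
    "\<And>y. y \<in> rel_interior P \<Longrightarrow> v \<bullet> p < v \<bullet> y"
    using supporting_hyperplane_rel_boundary[OF assms(1) \<open>p \<in> P\<close>] by blast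
  define G where "G = P \<inter> {x. v \<bullet> x = v \<bullet> p}"
  have G: "G face_of P"
    unfolding G_def using v(2) by (intro face_of_Int_supporting_hyperplane_ge assms(1)) auto
  have "S \<subseteq> G"
    using p \<open>p \<in> P\<close> face_of_imp_subset[OF S(1)]
    by (intro subset_of_face_of[OF G]) (auto simp: G_def disjnt_iff)
  then have SG: "S face_of G" using face_of_subset[OF S(1)] face_of_imp_subset[OF G] by blast
  obtain q where "q \<in> rel_interior P" using assms(1) \<open>p \<in> P\<close> rel_interior_eq_empty by blast
  then have "v \<bullet> p < v \<bullet> q" "q \<in> P" using v(3) rel_interior_subset by blast+
  then have "q \<in> P" "q \<notin> G" by (simp_all add: G_def)
  then have "G \<noteq> P" by blast
  then have "aff_dim G < aff_dim P" using face_of_aff_dim_lt[OF assms(1) G] by simp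
  then have "S = G"
    using face_of_aff_dim_lt[of G S] SG S(3) face_of_imp_convex[OF G] by fastforce
  then show thesis using that[of v "v \<bullet> p"] v unfolding G_def by blast
qed

lemma aff_dim_New:
  assumes "monoid_submodule L" "quadrant \<subseteq> L"
  shows "aff_dim (New L) = 2"
proof -
  have "real_point (0, 0) \<in> New L" using assms(2) by (intro real_point_in_New) (auto simp: quadrant_def)
  from New_mono[OF assms(1) this] have "{0<..<1} \<times> {0<..<1} \<subseteq> New L"
    by (auto simp: real_point_def)
  then have "{0<..<1} \<times> {0<..<1} \<subseteq> interior (New L)" by (rule interior_maximal) (intro open_Times; simp)
  moreover have "(1/2, 1/2) \<in> {0<..<1::real} \<times> {0<..<1::real}" by simp
  ultimately have "interior (New L) \<noteq> {}" by blast
  then show ?thesis by (simp add: aff_dim_nonempty_interior)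
qed

lemma aff_dim_region: "aff_dim (region a) = 2"
  using aff_dim_New[OF submodule_staircase quadrant_subset_staircase, of a] by (simp add: New_staircase)

lemma aff_dim_segment: "p \<noteq> q \<Longrightarrow> aff_dim (closed_segment p q) = 1" for p :: "'a::euclidean_space"
  by (simp add: segment_convex_hull aff_dim_convex_hull aff_dim_2)

lemma ray_unbounded:
  fixes u :: "'a::real_normed_vector"
  assumes "u \<noteq> 0"
  shows "\<not> bounded {p + t *\<^sub>R u |t. 0 \<le> t}"
proof
  assume "bounded {p + t *\<^sub>R u |t. 0 \<le> t}"
  then obtain B where B: "\<And>t. 0 \<le> t \<Longrightarrow> norm (p + t *\<^sub>R u) \<le> B" unfolding bounded_iff by blast
  define t where "t = (B + norm p + 1) / norm u"
  have "0 \<le> B" using order_trans[OF norm_ge_zero B[of 0]] by simp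
  then have "0 \<le> t" using assms by (simp add: t_def)
  have "norm (t *\<^sub>R u) = B + norm p + 1" using assms \<open>0 \<le> B\<close> by (simp add: t_def)
  then show False using B[OF \<open>0 \<le> t\<close>] norm_triangle_ineq4[of "p + t *\<^sub>R u" p] by simp
qed

lemma vertex_eq_iff: "1 \<le> t \<Longrightarrow> real_point (vertex a (t - 1)) = real_point (vertex a t) \<longleftrightarrow> a t = 0"
  by (cases t) (auto simp: real_point_def vertex_eq algebra_simps)

lemma bounded_edge: "bounded (edge a t)"
  by (simp add: edge_def bounded_closed_segment)

lemma edge_facet:
  assumes "1 \<le> t" "0 < a t"
  shows "edge a t facet_of region a"
proof -
  have "region a \<inter> {p. (1, real t) \<bullet> p = - real_of_int (support a t)} face_of region a"
    by (intro face_of_Int_supporting_hyperplane_ge convex_region) (auto simp: region_iff slack_nonneg_iff)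
  moreover have "region a \<inter> {p. (1, real t) \<bullet> p = - real_of_int (support a t)} = edge a t"
    unfolding edge_eq[OF assms(1), symmetric] by (auto simp: slack_eq_inner)
  moreover have "aff_dim (edge a t) = 1" using assms vertex_eq_iff[of t a] by (simp add: edge_def aff_dim_segment)
  ultimately show ?thesis by (auto simp: facet_of_def aff_dim_region)
qed

text \<open>Since a single constraint is binding at each height, horizontal sections are closed half lines.
  This is how a horizontal facet is recognised as a ray.\<close>
lemma region_row:
  assumes "(x1, y) \<in> region a"
  obtains x0 where "\<And>x. (x, y) \<in> region a \<longleftrightarrow> x0 \<le> x"
proof (cases "y < 0")
  case True
  with assms obtain s where s:
    "\<And>j. j < s \<Longrightarrow> real_of_int (depth a j) + y \<le> 0" "\<And>j. s \<le> j \<Longrightarrow> 0 \<le> real_of_int (depth a j) + y"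
    by (rule region_crossing) blast
  have "(x, y) \<in> region a \<longleftrightarrow> - (\<Sum>j<s. real_of_int (depth a j) + y) \<le> x" for x
  proof
    assume "(x, y) \<in> region a"
    then have "0 \<le> x + (\<Sum>j<s. real_of_int (depth a j) + y)" by (simp add: region_def)
    then show "- (\<Sum>j<s. real_of_int (depth a j) + y) \<le> x" by linarith
  next
    assume *: "- (\<Sum>j<s. real_of_int (depth a j) + y) \<le> x"
    have "0 \<le> x + (\<Sum>j<t. real_of_int (depth a j) + y)" for t
      using * crossing_minimises[of s "\<lambda>j. real_of_int (depth a j)" y t, OF s] by linarith
    then show "(x, y) \<in> region a" by (simp add: region_def)
  qed
  then show thesis by (rule that)
next
  case False
  have "(x, y) \<in> region a" if "0 \<le> x" for x
  proof -
    have "0 \<le> x + (\<Sum>j<t. real_of_int (depth a j) + y)" for t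
      using that False by (intro add_nonneg_nonneg sum_nonneg) simp_all
    then show ?thesis by (simp add: region_def)
  qed
  then show thesis using region_bounds(1)[of _ y a] by (intro that[of 0]) blast
qed

text \<open>A facet minimises a functional \<open>\<alpha> x + \<beta> y\<close> with nonnegative coefficients.  If one of them is
  zero, the facet is vertical or horizontal.  Otherwise the functional is, up to scaling and a constant, a convex
  combination of the consecutive constraints \<open>t\<close> and \<open>t + 1\<close> with \<open>t \<le> \<beta> / \<alpha> < t + 1\<close>; unless
  \<open>\<beta> / \<alpha>\<close> is the integer \<open>t\<close>, both are tight on the facet, which would then be a single vertex.\<close>
lemma facet_of_region_cases:
  assumes "S facet_of region a"
  obtains (vertical) "S = {(0, y) |y. 0 \<le> y}"
    | (horizontal) p where "S = {p + t *\<^sub>R (1, 0) |t. 0 \<le> t}"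
    | (edge) t where "1 \<le> t" "0 < a t" "S = edge a t"
proof -
  obtain v s where v0: "v \<noteq> 0" and min: "\<And>p. p \<in> region a \<Longrightarrow> s \<le> v \<bullet> p"
    and S: "S = {p \<in> region a. v \<bullet> p = s}"
    using facet_exposed[OF convex_region assms] by blast
  obtain \<alpha> \<beta> where v: "v = (\<alpha>, \<beta>)" by fastforce
  have dim: "aff_dim S = 1" using assms by (simp add: facet_of_def aff_dim_region)
  obtain p where p: "p \<in> S" using assms by (auto simp: facet_of_def)
  have nonneg_in: "(x, y) \<in> region a" if "0 \<le> x" "0 \<le> y" for x y
    using that by (simp add: region_def add_nonneg_nonneg sum_nonneg)
  have min': "s \<le> \<alpha> * x + \<beta> * y" if "(x, y) \<in> region a" for x y
    using min[OF that] by (simp add: v inner_prod_def)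
  have nonneg: "0 \<le> c" if "\<And>x. 0 \<le> x \<Longrightarrow> s \<le> c * x" for c :: real
  proof (rule ccontr)
    assume "\<not> 0 \<le> c"
    then have "c * ((\<bar>s\<bar> + 1) / - c) = - (\<bar>s\<bar> + 1)" by simp
    moreover have "0 \<le> (\<bar>s\<bar> + 1) / - c" using \<open>\<not> 0 \<le> c\<close> by (intro divide_nonneg_pos) auto
    ultimately show False using that[of "(\<bar>s\<bar> + 1) / - c"] by linarith
  qed
  have "0 \<le> \<alpha>" using min'[of _ 0] nonneg_in[of _ 0] by (intro nonneg) simp
  have "0 \<le> \<beta>" using min'[of 0] nonneg_in[of 0] by (intro nonneg) simp
  consider "\<beta> = 0" "0 < \<alpha>" | "\<alpha> = 0" "0 < \<beta>" | "0 < \<alpha>" "0 < \<beta>"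
    using v0 v \<open>0 \<le> \<alpha>\<close> \<open>0 \<le> \<beta>\<close> by (auto simp: less_le zero_prod_def)
  then show thesis
  proof cases
    case 1
    have "s \<le> 0" using min'[OF nonneg_in[of 0 0]] by simp
    moreover have "0 \<le> s" using p 1 region_bounds(1)[of "fst p" "snd p"] by (auto simp: S v inner_prod_def)
    ultimately have "S = {(x, y) \<in> region a. x = 0}" using 1 by (auto simp: S v inner_prod_def)
    moreover have "(0, y) \<in> region a \<longleftrightarrow> 0 \<le> y" for y
    proof
      assume "(0, y) \<in> region a"
      then have "0 \<le> slack a 1 (0, y)" by (simp only: region_iff)
      then show "0 \<le> y" by (simp add: slack_def)
    qed (simp add: nonneg_in)
    ultimately show thesis by (intro vertical) auto
  next
    case 2
    have S': "S = {(x, y) \<in> region a. y = s / \<beta>}" using 2 by (auto simp: S v inner_prod_def field_simps)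
    then obtain x1 where "(x1, s / \<beta>) \<in> region a" using p by auto
    then obtain x0 where x0: "\<And>x. (x, s / \<beta>) \<in> region a \<longleftrightarrow> x0 \<le> x"
      by (rule region_row) blast
    define y0 where "y0 = s / \<beta>"
    have row: "q \<in> S \<longleftrightarrow> x0 \<le> fst q \<and> snd q = y0" for q
      using x0[of "fst q"] by (cases q) (auto simp: S' y0_def[symmetric])
    have "S = {(x0, y0) + t *\<^sub>R (1, 0) |t. 0 \<le> t}"
    proof (intro subset_antisym subsetI)
      fix q assume "q \<in> S"
      then have "q = (x0, y0) + (fst q - x0) *\<^sub>R (1, 0) \<and> 0 \<le> fst q - x0"
        unfolding row by (simp add: prod_eq_iff)
      then show "q \<in> {(x0, y0) + t *\<^sub>R (1, 0) |t. 0 \<le> t}" by blast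
    next
      fix q assume "q \<in> {(x0, y0) + t *\<^sub>R (1, 0) |t. 0 \<le> t}"
      then show "q \<in> S" unfolding row by auto
    qed
    then show thesis by (rule horizontal)
  next
    case 3
    define \<tau> where "\<tau> = \<beta> / \<alpha>"
    define t where "t = nat \<lfloor>\<tau>\<rfloor>"
    define l where "l = \<tau> - real t"
    have "0 < \<tau>" using 3 by (simp add: \<tau>_def)
    have \<beta>: "\<beta> = \<alpha> * \<tau>" using 3 by (simp add: \<tau>_def)
    have "real t = of_int \<lfloor>\<tau>\<rfloor>" using \<open>0 < \<tau>\<close> by (simp add: t_def)
    then have l: "0 \<le> l" "l < 1" unfolding l_def by linarith+
    have split: "v \<bullet> q = \<alpha> * ((1 - l) * slack a t q + l * slack a (Suc t) q)
        - \<alpha> * (real_of_int (support a t) + l * real_of_int (depth a t))" for q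
    proof -
      have "\<alpha> * (fst q + (real t + l) * snd q) = v \<bullet> q"
        by (simp add: l_def v inner_prod_def \<beta> distrib_left)
      moreover have "(1 - l) * slack a t q + l * slack a (Suc t) q
          = fst q + (real t + l) * snd q + (real_of_int (support a t) + l * real_of_int (depth a t))"
        by (simp add: slack_def algebra_simps)
      ultimately show ?thesis by (simp only: distrib_left add_diff_cancel_right')
    qed
    let ?g = "\<lambda>q. (1 - l) * slack a t q + l * slack a (Suc t) q"
    have ge: "0 \<le> ?g q" if "q \<in> region a" for q
      using that l by (auto simp: region_iff intro!: add_nonneg_nonneg mult_nonneg_nonneg)
    \<comment> \<open>Both slacks vanish at the vertex \<open>t\<close>, so that the minimum of \<open>?g\<close> on the region is \<open>0\<close>.\<close>
    let ?V = "real_point (vertex a t)"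
    have gV: "?g ?V = 0" by simp
    have "v \<bullet> p = s" "p \<in> region a" using p by (auto simp: S)
    then have "v \<bullet> p \<le> v \<bullet> ?V" using min[OF real_vertex_in_region] by simp
    then have "\<alpha> * ?g p \<le> 0" unfolding split gV by simp
    then have "?g p = 0" using ge[OF \<open>p \<in> region a\<close>] 3
      by (metis mult_le_0_iff not_less order_antisym)
    then have s: "s = - \<alpha> * (real_of_int (support a t) + l * real_of_int (depth a t))"
      using \<open>v \<bullet> p = s\<close> split[of p] by simp
    have S': "S = {q \<in> region a. ?g q = 0}"
      unfolding S s split using 3 by auto
    show thesis
    proof (cases "l = 0")
      case False
      have "q = ?V" if "q \<in> S" for q
      proof -
        have "0 \<le> slack a t q" "0 \<le> slack a (Suc t) q" "?g q = 0"
          using that by (auto simp: S' region_iff)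
        moreover have "0 < 1 - l" "0 < l" using l False by simp_all
        ultimately have "(1 - l) * slack a t q = 0 \<and> l * slack a (Suc t) q = 0"
          by (subst add_nonneg_eq_0_iff[symmetric]) simp_all
        with \<open>0 < 1 - l\<close> \<open>0 < l\<close> have "slack a t q = 0 \<and> slack a (Suc t) q = 0" by auto
        then show ?thesis by (simp add: eq_vertex_iff)
      qed
      then have "S = {?V}" using p by blast
      then show thesis using dim by simp
    next
      case True
      have "t \<noteq> 0" using \<open>0 < \<tau>\<close> True l_def by auto
      then have t: "1 \<le> t" by simp
      have "S = edge a t" unfolding S' edge_eq[OF t, symmetric] True by simp
      moreover have "a t \<noteq> 0"
      proof
        assume "a t = 0"
        then show False using dim vertex_eq_iff[OF t, of a] \<open>S = edge a t\<close> by (simp add: edge_def)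
      qed
      ultimately show thesis using t by (intro edge) auto
    qed
  qed
qed

lemma finite_facet_region:
  "finite_facet S (region a) \<longleftrightarrow> (\<exists>t\<ge>1. 0 < a t \<and> S = edge a t)"
proof
  assume "finite_facet S (region a)"
  then have S: "S facet_of region a" "bounded S" by (auto simp: finite_facet_def)
  from S(1) show "\<exists>t\<ge>1. 0 < a t \<and> S = edge a t"
  proof (cases rule: facet_of_region_cases)
    case vertical
    have "{0 + t *\<^sub>R (0, 1) |t. 0 \<le> t} = {(0::real, y::real) |y. 0 \<le> y}" by auto
    then show ?thesis using S(2) vertical ray_unbounded[of "(0, 1) :: real \<times> real" 0] by (simp add: zero_prod_def)
  next
    case (horizontal p)
    then show ?thesis using S(2) ray_unbounded[of "(1, 0) :: real \<times> real" p] by (simp add: zero_prod_def)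
  next
    case (edge t)
    then show ?thesis by blast
  qed
next
  assume "\<exists>t\<ge>1. 0 < a t \<and> S = edge a t"
  then show "finite_facet S (region a)" by (auto simp: finite_facet_def edge_facet bounded_edge)
qed

lemma outward_normal_edge:
  assumes "1 \<le> t" "0 < a t"
  shows "outward_normal (region a) (edge a t) (-1, - real k) \<longleftrightarrow> k = t"
proof
  assume "outward_normal (region a) (edge a t) (-1, - real k)"
  then obtain s where s: "edge a t = region a \<inter> {x. (-1, - real k) \<bullet> x = s}"
    by (auto simp: outward_normal_def)
  have "real_point (vertex a (t - 1)) \<in> edge a t" "real_point (vertex a t) \<in> edge a t" by (simp_all add: edge_def)
  then have "(-1, - real k) \<bullet> real_point (vertex a (t - 1)) = (-1, - real k) \<bullet> real_point (vertex a t)"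
    unfolding s by simp
  moreover obtain r where r: "t = Suc r" using assms by (cases t) auto
  ultimately have "(real k - real t) * real (a t) = 0"
    by (simp add: real_point_def vertex_eq inner_prod_def r algebra_simps)
  then show "k = t" using assms by simp
next
  assume k: "k = t"
  have "region a \<subseteq> {x. (-1, - real t) \<bullet> x \<le> real_of_int (support a t)}"
    by (auto simp: region_iff slack_eq_inner inner_prod_def dest!: spec[of _ t])
  moreover have "edge a t = region a \<inter> {x. (-1, - real t) \<bullet> x = real_of_int (support a t)}"
    unfolding edge_eq[OF assms(1), symmetric] by (auto simp: slack_eq_inner inner_prod_def)
  ultimately show "outward_normal (region a) (edge a t) (-1, - real k)"
    unfolding outward_normal_def k by (auto simp: zero_prod_def)
qed

text \<open>The vertex is the intersection of the faces cut out by two consecutive constraints.\<close>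
lemma vertex_extreme: "real_point (vertex a t) extreme_point_of region a"
proof -
  have face: "region a \<inter> {p. (1, real s) \<bullet> p = - real_of_int (support a s)} face_of region a" for s
    by (intro face_of_Int_supporting_hyperplane_ge convex_region) (auto simp: region_iff slack_nonneg_iff)
  have "{real_point (vertex a t)} =
      (region a \<inter> {p. (1, real t) \<bullet> p = - real_of_int (support a t)}) \<inter>
      (region a \<inter> {p. (1, real (Suc t)) \<bullet> p = - real_of_int (support a (Suc t))})" (is "_ = ?R")
  proof (intro Set.set_eqI)
    fix p
    have "p \<in> ?R \<longleftrightarrow> p \<in> region a \<and> slack a t p = 0 \<and> slack a (Suc t) p = 0"
      unfolding slack_eq_inner eq_neg_iff_add_eq_0 by blast
    then show "p \<in> {real_point (vertex a t)} \<longleftrightarrow> p \<in> ?R"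
      unfolding eq_vertex_iff[symmetric] using real_vertex_in_region by auto
  qed
  then have "{real_point (vertex a t)} face_of region a" using face_of_Int[OF face face] by metis
  then show ?thesis by (simp only: face_of_singleton)
qed

text \<open>The facet conditions are read off from the list of facets.  The polyhedron contains no ray of
  negative slope because \<open>x + n y\<close> is bounded below for every \<open>n\<close>, however small the slope.\<close>
lemma staircase_in_A: "staircase a \<in> \<A>"
  unfolding \<A>_def mem_Collect_eq New_staircase
proof (intro conjI)
  show "monoid_submodule (staircase a)" by (rule submodule_staircase)
  show "co_artinian (staircase a)"
    unfolding co_artinian_def
  proof
    assume "\<exists>f::nat \<Rightarrow> int \<times> int. (\<forall>n. f n \<in> staircase a) \<and> (\<forall>n. f (Suc n) < f n)"
    then obtain f :: "nat \<Rightarrow> int \<times> int" where f: "\<And>n. f n \<in> staircase a" "\<And>n. f (Suc n) < f n" by blast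
    \<comment> \<open>\<open>x + y\<close> is bounded below by \<open>0\<close> on the staircase, and decreases strictly\<close>
    let ?s = "\<lambda>n. fst (f n) + snd (f n)"
    have "?s (Suc n) < ?s n" for n
      using f(2)[of n] by (auto simp: less_prod_def less_eq_prod_def)
    then have "?s n \<le> ?s 0 - int n" for n
    proof (induction n)
      case (Suc n)
      from Suc.IH[OF Suc.prems] Suc.prems[of n] show ?case by simp
    qed simp
    moreover have "0 \<le> ?s n" for n
      using f(1)[of n] staircase_iff_support[of "fst (f n)" "snd (f n)" a] by (auto dest!: spec[of _ 1])
    ultimately have "int n \<le> ?s 0" for n by (metis add.commute diff_ge_0_iff_ge order_trans)
    from this[of "nat (?s 0) + 1"] show False by linarith
  qed
  show "integrally_closed (staircase a)"
    unfolding integrally_closed_def New_staircase by (rule staircase_def)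
  show "quadrant \<subseteq> staircase a" by (rule quadrant_subset_staircase)
  show "\<forall>(x, y)\<in>staircase a. 0 \<le> x" using staircase_bounds(1) by blast
  show "\<forall>y. (0, y) \<in> staircase a \<longrightarrow> 0 \<le> y"
    by (auto simp: staircase_iff_support dest!: spec[of _ 1])
  show "\<nexists>x y::real. y < 0 \<and> 0 < x \<and> {t *\<^sub>R (x, y) |t. 0 \<le> t} \<subseteq> region a"
  proof
    assume "\<exists>x y::real. y < 0 \<and> 0 < x \<and> {t *\<^sub>R (x, y) |t. 0 \<le> t} \<subseteq> region a"
    then obtain x y :: real where xy: "y < 0" "0 < x" and ray: "{t *\<^sub>R (x, y) |t. 0 \<le> t} \<subseteq> region a" by blast
    obtain n :: nat where "x / - y < real n" using reals_Archimedean2 by blast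
    then have neg: "x + real n * y < 0" using xy by (simp add: field_simps)
    define \<delta> where "\<delta> = - (x + real n * y)"
    have "0 < \<delta>" using neg by (simp add: \<delta>_def)
    have le: "t * \<delta> \<le> real_of_int (support a n)" if "0 \<le> t" for t
    proof -
      have "t *\<^sub>R (x, y) \<in> region a" using ray that by blast
      then have "0 \<le> slack a n (t *\<^sub>R (x, y))" unfolding region_iff ..
      also have "slack a n (t *\<^sub>R (x, y)) = real_of_int (support a n) - t * \<delta>"
        by (simp add: slack_def \<delta>_def algebra_simps)
      finally show ?thesis by simp
    qed
    let ?c = "\<bar>real_of_int (support a n)\<bar> + 1"
    have "?c / \<delta> * \<delta> = ?c" "0 \<le> ?c / \<delta>" using \<open>0 < \<delta>\<close> by simp_all
    then show False using le[of "?c / \<delta>"] by linarith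
  qed
  show "\<forall>S. infinite_facet S (region a) \<longrightarrow>
      S = {(0, y) |y. 0 \<le> y} \<or> (\<exists>p s. s \<noteq> 0 \<and> S = {p + t *\<^sub>R (s, 0) |t. 0 \<le> t})"
  proof (intro allI impI)
    fix S assume S: "infinite_facet S (region a)"
    then have "S facet_of region a" by (simp add: infinite_facet_def)
    then show "S = {(0, y) |y. 0 \<le> y} \<or> (\<exists>p s. s \<noteq> 0 \<and> S = {p + t *\<^sub>R (s, 0) |t. 0 \<le> t})"
    proof (cases rule: facet_of_region_cases)
      case (horizontal p)
      then show ?thesis by (intro disjI2 exI[of _ p] exI[of _ 1]) simp
    next
      case (edge t)
      then show ?thesis using S by (simp add: infinite_facet_def bounded_edge)
    qed simp
  qed
  show "\<forall>S. finite_facet S (region a) \<longrightarrow>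
      (\<exists>k m c d :: int. 0 < k \<and> 0 < m \<and> d \<le> 0 \<and> 0 \<le> c \<and>
         real_point (c, d) extreme_point_of region a \<and>
         real_point (c + m * k, d - m) extreme_point_of region a \<and>
         S = closed_segment (real_point (c, d)) (real_point (c + m * k, d - m)))"
  proof (intro allI impI)
    fix S assume "finite_facet S (region a)"
    then obtain t where t: "1 \<le> t" "0 < a t" "S = edge a t" unfolding finite_facet_region by blast
    obtain c d where cd: "vertex a (t - 1) = (c, d)" by fastforce
    have "0 \<le> c" "d \<le> 0" using cd by (auto simp: vertex_def intro!: sum_nonneg depth_mono)
    moreover have v: "vertex a t = (c + int (a t) * int t, d - int (a t))"
      using cd t(1) by (cases t) (auto simp: vertex_eq algebra_simps)
    moreover have "S = closed_segment (real_point (c, d)) (real_point (c + int (a t) * int t, d - int (a t)))"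
      using t(3) unfolding edge_def cd v .
    moreover note vertex_extreme[of a "t - 1", unfolded cd] vertex_extreme[of a t, unfolded v]
    ultimately show "\<exists>k m c d :: int. 0 < k \<and> 0 < m \<and> d \<le> 0 \<and> 0 \<le> c \<and>
         real_point (c, d) extreme_point_of region a \<and>
         real_point (c + m * k, d - m) extreme_point_of region a \<and>
         S = closed_segment (real_point (c, d)) (real_point (c + m * k, d - m))"
      using t by (intro exI[of _ "int t"] exI[of _ "int (a t)"] exI[of _ c] exI[of _ d]) simp
  qed
qed

lemma staircase_in_A_upto_iff:
  "staircase a \<in> \<A>_upto n \<longleftrightarrow> (\<forall>j>n. a j = 0)"
proof -
  have "(\<exists>k\<in>{1..n}. outward_normal (region a) (edge a t) (-1, - real k)) \<longleftrightarrow> t \<le> n"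
    if "1 \<le> t" "0 < a t" for t
    using that by (auto simp: outward_normal_edge)
  then have "staircase a \<in> \<A>_upto n \<longleftrightarrow> (\<forall>t\<ge>1. 0 < a t \<longrightarrow> t \<le> n)"
    unfolding \<A>_upto_def mem_Collect_eq New_staircase finite_facet_region using staircase_in_A by blast
  also have "\<dots> \<longleftrightarrow> (\<forall>j>n. a j = 0)"
  proof safe
    fix j assume "\<forall>t\<ge>1. 0 < a t \<longrightarrow> t \<le> n" "n < j"
    then show "a j = 0" by (metis One_nat_def Suc_leI gr0I gr_implies_not0 not_le)
  next
    fix t assume "\<forall>j>n. a j = 0" "0 < a t"
    then show "t \<le> n" by (metis not_le less_irrefl)
  qed
  finally show ?thesis .
qed

section \<open>Recognising staircases\<close>

text \<open>The integral linear functional whose minima over a member of \<open>\<A>\<close> determine it.\<close>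
definition level :: "nat \<Rightarrow> int \<times> int \<Rightarrow> int" where
  "level t p = fst p + int t * snd p"

lemma level_Suc: "level (Suc t) p = level t p + snd p"
  by (simp add: level_def algebra_simps)

lemma int_min_attained:
  fixes f :: "'a \<Rightarrow> int"
  assumes "p0 \<in> Y" "\<And>q. q \<in> Y \<Longrightarrow> m \<le> f q"
  obtains p where "p \<in> Y" "\<And>q. q \<in> Y \<Longrightarrow> f p \<le> f q"
proof -
  obtain p where p: "p \<in> Y" "\<And>q. q \<in> Y \<Longrightarrow> nat (f p - m) \<le> nat (f q - m)"
    using ex_has_least_nat[of "\<lambda>p. p \<in> Y" p0 "\<lambda>p. nat (f p - m)"] assms(1) by blast
  have "f p \<le> f q" if "q \<in> Y" for q
    using p(2)[OF that] assms(2)[OF that] assms(2)[OF p(1)] by linarith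
  then show thesis using that p(1) by blast
qed

lemma
  assumes "L \<in> \<A>"
  shows A_submodule: "monoid_submodule L"
    and A_integrally_closed: "integrally_closed L"
    and A_quadrant: "quadrant \<subseteq> L"
    and A_fst_nonneg: "p \<in> L \<Longrightarrow> 0 \<le> fst p"
    and A_axis: "p \<in> L \<Longrightarrow> fst p = 0 \<Longrightarrow> 0 \<le> snd p"
    and A_no_ray: "y < 0 \<Longrightarrow> 0 < x \<Longrightarrow> \<not> {t *\<^sub>R (x, y) |t. 0 \<le> t} \<subseteq> New L"
    and A_finite_facet: "finite_facet S (New L) \<Longrightarrow>
       \<exists>k m c d :: int. 0 < m \<and> S = closed_segment (real_point (c, d)) (real_point (c + m * k, d - m))"
proof -
  note A = assms[unfolded \<A>_def mem_Collect_eq]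
  show "monoid_submodule L" "integrally_closed L" "quadrant \<subseteq> L" using A by simp_all
  show "p \<in> L \<Longrightarrow> 0 \<le> fst p" "p \<in> L \<Longrightarrow> fst p = 0 \<Longrightarrow> 0 \<le> snd p"
    using A by (cases p; force)+
  show "y < 0 \<Longrightarrow> 0 < x \<Longrightarrow> \<not> {t *\<^sub>R (x, y) |t. 0 \<le> t} \<subseteq> New L" using A by blast
  show "\<exists>k m c d :: int. 0 < m \<and> S = closed_segment (real_point (c, d)) (real_point (c + m * k, d - m))"
    if "finite_facet S (New L)"
  proof -
    have "\<forall>S. finite_facet S (New L) \<longrightarrow>
        (\<exists>k m c d :: int. 0 < k \<and> 0 < m \<and> d \<le> 0 \<and> 0 \<le> c \<and>
           real_point (c, d) extreme_point_of New L \<and>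
           real_point (c + m * k, d - m) extreme_point_of New L \<and>
           S = closed_segment (real_point (c, d)) (real_point (c + m * k, d - m)))"
      using A by (elim conjE)
    from this[rule_format, OF that] show ?thesis by blast
  qed
qed

lemma A_zero: "L \<in> \<A> \<Longrightarrow> (0, 0) \<in> L"
  using A_quadrant by (auto simp: quadrant_def)

text \<open>If \<open>x + t y\<close> were unbounded below, arbitrarily low points of the ray through \<open>(t, -1)\<close> would
  belong to the submodule, being to the right of points of it, and by convexity so would the whole ray,
  which is excluded.\<close>
lemma level_bounded_below:
  assumes L: "L \<in> \<A>"
  shows "\<exists>m. \<forall>p\<in>L. m \<le> level t p"
proof (cases t)
  case 0
  then show ?thesis using A_fst_nonneg[OF L] by (intro exI[of _ 0]) (simp add: level_def)
next
  case (Suc t')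
  then have t: "0 < t" by simp
  show ?thesis
  proof (rule ccontr)
    assume "\<not> ?thesis"
    then have unbdd: "\<exists>p\<in>L. level t p < m" for m by (meson not_le)
    have "{s *\<^sub>R (real t, - 1) |s. 0 \<le> s} \<subseteq> New L"
    proof
      fix q :: "real \<times> real" assume "q \<in> {s *\<^sub>R (real t, - 1) |s. 0 \<le> s}"
      then obtain s where q: "q = s *\<^sub>R (real t, - 1)" and "0 \<le> s" by blast
      obtain n :: nat where n: "s \<le> real n" using real_arch_simple by blast
      obtain x y where xy: "(x, y) \<in> L" and lt: "level t (x, y) < - (int t * int n)"
        using unbdd[of "- (int t * int n)"] by (metis surj_pair)
      have "0 \<le> x" using A_fst_nonneg[OF L xy] by simp
      with lt have "int t * y < int t * (- int n)" by (simp add: level_def)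
      then have y: "y < - int n" using t by (subst (asm) mult_less_cancel_left_pos) simp_all
      have "x + int t * y < 0"
        using lt by (simp add: level_def) (metis le_less_trans less_trans mult_nonneg_nonneg neg_le_0_iff_le not_le of_nat_0_le_iff)
      then have "(- int t * y, y) \<in> L"
        by (intro submodule_mono[OF A_submodule[OF L] xy]) simp_all
      then have P: "real_point (- int t * y, y) \<in> New L" by (rule real_point_in_New)
      have O: "real_point (0, 0) \<in> New L" using A_zero[OF L] by (rule real_point_in_New)
      define u where "u = s / - real_of_int y"
      have "real n < - real_of_int y" using y by linarith
      then have pos: "0 < - real_of_int y" and "s \<le> - real_of_int y" using n by linarith+
      then have u: "0 \<le> u" "u \<le> 1"
        unfolding u_def using \<open>0 \<le> s\<close> by (simp_all only: pos_divide_le_eq pos_le_divide_eq mult_1 mult_zero_left)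
      have s: "s = - (u * real_of_int y)" using pos by (simp add: u_def)
      have "q = (1 - u) *\<^sub>R real_point (0, 0) + u *\<^sub>R real_point (- int t * y, y)"
        by (simp add: q real_point_def s)
      then show "q \<in> New L"
        using convexD_alt[OF convex_New O P u] by simp
    qed
    then show False using A_no_ray[OF L, of "- 1" "real t"] t by simp
  qed
qed

lemma level_minimiser:
  assumes "L \<in> \<A>"
  obtains p where "p \<in> L" "\<And>q. q \<in> L \<Longrightarrow> level t p \<le> level t q"
  using level_bounded_below[OF assms, of t] A_zero[OF assms] int_min_attained[of _ L _ "level t"] by metis

lemma New_halfspace:
  assumes "\<And>x y. (x, y) \<in> L \<Longrightarrow> s \<le> real_of_int x + \<tau> * real_of_int y" "p \<in> New L"
  shows "s \<le> (1, \<tau>) \<bullet> p"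
proof -
  have "New L \<subseteq> {p. (1, \<tau>) \<bullet> p \<ge> s}"
    unfolding New_def using assms(1)
    by (intro hull_minimal convex_halfspace_ge) (auto simp: real_point_def inner_prod_def)
  then show ?thesis using assms(2) by auto
qed

text \<open>A supporting line of nonintegral slope parameter \<open>\<tau>\<close>, with \<open>t < \<tau> < t + 1\<close>, that meets two points
  of the set cuts out a facet.  It is bounded because \<open>x + t y\<close> and \<open>x + (t + 1) y\<close> are bounded
  below.  Since finite facets have integral slope parameter, there is no such line.\<close>
lemma supporting_slope_integral:
  assumes L: "L \<in> \<A>"
    and \<tau>: "real t < \<tau>" "\<tau> < real (Suc t)"
    and supp: "\<And>x y. (x, y) \<in> L \<Longrightarrow> s \<le> real_of_int x + \<tau> * real_of_int y"
    and p: "p \<in> L" "real_of_int (fst p) + \<tau> * real_of_int (snd p) = s"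
    and q: "q \<in> L" "real_of_int (fst q) + \<tau> * real_of_int (snd q) = s"
  shows "p = q"
proof (rule ccontr)
  assume "p \<noteq> q"
  define S where "S = New L \<inter> {p. (1, \<tau>) \<bullet> p = s}"
  have face: "S face_of New L"
    unfolding S_def using New_halfspace[OF supp]
    by (intro face_of_Int_supporting_hyperplane_ge convex_New) auto
  have pq: "real_point p \<in> S" "real_point q \<in> S"
    using p q real_point_in_New[OF p(1)] real_point_in_New[OF q(1)]
    by (simp_all add: S_def real_point_def inner_prod_def)
  have "aff_dim S = 1"
  proof (rule antisym)
    have "real_point p + (1, 0) \<in> New L"
      by (intro New_mono A_submodule[OF L] real_point_in_New p(1)) simp_all
    moreover have "real_point p + (1, 0) \<notin> S" using p(2) by (auto simp: S_def real_point_def inner_prod_def)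
    ultimately have "S \<noteq> New L" by blast
    then have "aff_dim S < 2"
      using face_of_aff_dim_lt[OF convex_New face] aff_dim_New[OF A_submodule[OF L] A_quadrant[OF L]] by simp
    then show "aff_dim S \<le> 1" by simp
    have "real_point p \<noteq> real_point q" using \<open>p \<noteq> q\<close> by (auto simp: real_point_def prod_eq_iff)
    then have "1 = aff_dim (closed_segment (real_point p) (real_point q))" by (simp add: aff_dim_segment)
    also have "\<dots> \<le> aff_dim S"
      by (intro aff_dim_subset closed_segment_subset pq face_of_imp_convex[OF face])
    finally show "1 \<le> aff_dim S" .
  qed
  then have "S facet_of New L"
    using face pq aff_dim_New[OF A_submodule[OF L] A_quadrant[OF L]] by (auto simp: facet_of_def)
  moreover have "bounded S"
  proof -
    obtain m1 m2 where m1: "\<forall>p\<in>L. m1 \<le> level t p" and m2: "\<forall>p\<in>L. m2 \<le> level (Suc t) p"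
      using level_bounded_below[OF L] by meson
    have le1: "real_of_int m1 \<le> (1, real t) \<bullet> r" if "r \<in> New L" for r
    proof (rule New_halfspace[OF _ that])
      fix x y assume "(x, y) \<in> L"
      then have "m1 \<le> x + int t * y" using m1 by (auto simp: level_def)
      then have "real_of_int m1 \<le> real_of_int (x + int t * y)" by (simp only: of_int_le_iff)
      then show "real_of_int m1 \<le> real_of_int x + real t * real_of_int y" by simp
    qed
    have le2: "real_of_int m2 \<le> (1, real (Suc t)) \<bullet> r" if "r \<in> New L" for r
    proof (rule New_halfspace[OF _ that])
      fix x y assume "(x, y) \<in> L"
      then have "m2 \<le> x + int (Suc t) * y" using m2 by (auto simp: level_def)
      then have "real_of_int m2 \<le> real_of_int (x + int (Suc t) * y)" by (simp only: of_int_le_iff)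
      then show "real_of_int m2 \<le> real_of_int x + real (Suc t) * real_of_int y" by simp
    qed
    define lo hi where "lo = (real_of_int m2 - s) / (real (Suc t) - \<tau>)" and "hi = (s - real_of_int m1) / (\<tau> - real t)"
    have "S \<subseteq> (\<lambda>y. (s - \<tau> * y, y)) ` {lo..hi}"
    proof
      fix r assume r: "r \<in> S"
      then have "r \<in> New L" and s: "fst r + \<tau> * snd r = s" by (auto simp: S_def inner_prod_def)
      have "real_of_int m1 \<le> fst r + real t * snd r" "real_of_int m2 \<le> fst r + real (Suc t) * snd r"
        using le1[OF \<open>r \<in> New L\<close>] le2[OF \<open>r \<in> New L\<close>] by (auto simp: inner_prod_def)
      then have "snd r * (\<tau> - real t) \<le> s - real_of_int m1" "real_of_int m2 - s \<le> snd r * (real (Suc t) - \<tau>)"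
        unfolding s[symmetric] by (simp_all add: algebra_simps)
      then have "snd r \<in> {lo..hi}"
        using \<tau> by (simp add: lo_def hi_def pos_divide_le_eq pos_le_divide_eq)
      moreover have "r = (s - \<tau> * snd r, snd r)" using s by (simp add: prod_eq_iff)
      ultimately show "r \<in> (\<lambda>y. (s - \<tau> * y, y)) ` {lo..hi}" by blast
    qed
    moreover have "bounded ((\<lambda>y. (s - \<tau> * y, y)) ` {lo..hi})"
      by (intro compact_imp_bounded compact_continuous_image continuous_intros) simp
    ultimately show ?thesis by (rule bounded_subset[rotated])
  qed
  ultimately have "finite_facet S (New L)" by (simp add: finite_facet_def)
  then obtain k m c d :: int where "0 < m"
    and S: "S = closed_segment (real_point (c, d)) (real_point (c + m * k, d - m))"
    using A_finite_facet[OF L] by blast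
  have "real_point (c, d) \<in> S" "real_point (c + m * k, d - m) \<in> S" by (simp_all add: S)
  then have on_line: "real_of_int c + \<tau> * real_of_int d = s"
    "real_of_int c + real_of_int m * real_of_int k + \<tau> * (real_of_int d - real_of_int m) = s"
    by (simp_all add: S_def real_point_def inner_prod_def)
  have "real_of_int m * (real_of_int k - \<tau>) = (real_of_int c + real_of_int m * real_of_int k
      + \<tau> * (real_of_int d - real_of_int m)) - (real_of_int c + \<tau> * real_of_int d)"
    by (simp add: algebra_simps)
  then have "real_of_int m * (real_of_int k - \<tau>) = 0" unfolding on_line by simp
  then have "real_of_int k = \<tau>" using \<open>0 < m\<close> by simp
  then have "real_of_int (int t) < real_of_int k" "real_of_int k < real_of_int (int (Suc t))"
    using \<tau> by simp_all
  then show False unfolding of_int_less_iff by simp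
qed

text \<open>Take the lowest minimiser \<open>p\<close> of \<open>x + t y\<close>.  If it did not minimise \<open>x + (t + 1) y\<close>, then
  tilting the supporting line at \<open>p\<close> would make it hit another point before the slope parameter
  reaches \<open>t + 1\<close>, contradicting \<open>supporting_slope_integral\<close>.  Only finitely many points can be hit, so there is
  a first one.\<close>
lemma consecutive_minimiser:
  assumes L: "L \<in> \<A>"
  shows "\<exists>p\<in>L. \<forall>q\<in>L. level t p \<le> level t q \<and> level (Suc t) p \<le> level (Suc t) q"
proof -
  obtain p0 where p0: "p0 \<in> L" "\<And>q. q \<in> L \<Longrightarrow> level t p0 \<le> level t q"
    using level_minimiser[OF L] by blast
  obtain q0 where q0: "q0 \<in> L" "\<And>q. q \<in> L \<Longrightarrow> level (Suc t) q0 \<le> level (Suc t) q"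
    using level_minimiser[OF L] by blast
  let ?M = "{q \<in> L. level t q = level t p0}"
  obtain p where p: "p \<in> ?M" "\<And>q. q \<in> ?M \<Longrightarrow> level (Suc t) p \<le> level (Suc t) q"
    by (rule int_min_attained[of p0 ?M "level (Suc t) q0" "level (Suc t)"]) (use p0 q0 in auto)
  have pL: "p \<in> L" and pmin: "\<And>q. q \<in> L \<Longrightarrow> level t p \<le> level t q" using p(1) p0(2) by simp_all
  have "level (Suc t) p \<le> level (Suc t) q0"
  proof (rule ccontr)
    assume "\<not> level (Suc t) p \<le> level (Suc t) q0"
    then have q0p: "level (Suc t) q0 < level (Suc t) p" by simp
    \<comment> \<open>the points that the line turning about \<open>p\<close> hits no later than at slope parameter \<open>t + 1\<close>\<close>
    define C where "C = {q \<in> L. snd q < snd p \<and> level (Suc t) q \<le> level (Suc t) p}"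
    have "q0 \<in> C"
      using q0(1) q0p pmin[OF q0(1)] by (simp add: C_def level_Suc)
    \<comment> \<open>The bound for \<open>t + 2\<close> keeps the candidates from descending indefinitely.\<close>
    obtain m where m: "\<forall>q\<in>L. m \<le> level (Suc (Suc t)) q" using level_bounded_below[OF L] by blast
    have "C \<subseteq> {0..level (Suc t) p - int (Suc t) * (m - level (Suc t) p)} \<times> {m - level (Suc t) p..snd p}"
    proof
      fix q assume q: "q \<in> C"
      then have "0 \<le> fst q" using A_fst_nonneg[OF L] by (simp add: C_def)
      have lo: "m - level (Suc t) p \<le> snd q" using q m by (fastforce simp: C_def level_Suc)
      have "fst q + int (Suc t) * snd q \<le> level (Suc t) p" using q by (simp add: C_def level_def)
      moreover have "int (Suc t) * (m - level (Suc t) p) \<le> int (Suc t) * snd q"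
        using lo by (intro mult_left_mono) simp_all
      ultimately have "fst q \<le> level (Suc t) p - int (Suc t) * (m - level (Suc t) p)" by linarith
      then show "q \<in> {0..level (Suc t) p - int (Suc t) * (m - level (Suc t) p)} \<times> {m - level (Suc t) p..snd p}"
        using lo \<open>0 \<le> fst q\<close> q by (cases q) (simp add: C_def)
    qed
    then have "finite C" by (rule finite_subset) simp
    define slope where "slope = (\<lambda>q :: int \<times> int. real_of_int (fst q - fst p) / real_of_int (snd p - snd q))"
    define r where "r = arg_min_on slope C"
    have r: "r \<in> C" "\<And>q. q \<in> C \<Longrightarrow> slope r \<le> slope q"
      using arg_min_if_finite(1)[OF \<open>finite C\<close>, of slope] arg_min_least[OF \<open>finite C\<close>, of _ slope] \<open>q0 \<in> C\<close>
      by (auto simp: r_def)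
    define \<tau> where "\<tau> = slope r"
    have slope: "slope q * real_of_int (snd p - snd q) = real_of_int (fst q - fst p)" if "snd q < snd p" for q
      using that by (simp add: slope_def)
    have less_slope: "real k < slope q \<longleftrightarrow> level k p < level k q" if "snd q < snd p" for k q
    proof -
      have "real k < slope q \<longleftrightarrow> real_of_int (int k * (snd p - snd q)) < real_of_int (fst q - fst p)"
        using that by (simp add: slope_def pos_less_divide_eq)
      then show ?thesis unfolding of_int_less_iff by (auto simp: level_def algebra_simps)
    qed
    have slope_less: "slope q < real k \<longleftrightarrow> level k q < level k p" if "snd q < snd p" for k q
    proof -
      have "slope q < real k \<longleftrightarrow> real_of_int (fst q - fst p) < real_of_int (int k * (snd p - snd q))"
        using that by (simp add: slope_def pos_divide_less_eq)
      then show ?thesis unfolding of_int_less_iff by (auto simp: level_def algebra_simps)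
    qed
    have rp: "r \<in> L" "snd r < snd p" using r(1) by (simp_all add: C_def)
    have "level t p < level t r"
    proof (rule ccontr)
      assume "\<not> level t p < level t r"
      then have "level t r = level t p" using pmin[OF rp(1)] by simp
      then have "r \<in> ?M" using p(1) rp(1) by simp
      from p(2)[OF this] show False using \<open>level t r = level t p\<close> rp(2) by (simp add: level_Suc)
    qed
    then have lo: "real t < \<tau>" using rp(2) by (simp add: less_slope \<tau>_def)
    have "slope q0 < real (Suc t)"
      using q0p \<open>q0 \<in> C\<close> by (subst slope_less) (simp_all add: C_def)
    then have hi: "\<tau> < real (Suc t)" using r(2)[OF \<open>q0 \<in> C\<close>] by (simp add: \<tau>_def)
    define s where "s = real_of_int (fst p) + \<tau> * real_of_int (snd p)"
    have supp: "s \<le> real_of_int x + \<tau> * real_of_int y" if xy: "(x, y) \<in> L" for x y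
    proof (cases "y < snd p")
      case True
      have "\<tau> \<le> slope (x, y)"
      proof (cases "(x, y) \<in> C")
        case True then show ?thesis using r(2) by (simp add: \<tau>_def)
      next
        case False
        then have "level (Suc t) p < level (Suc t) (x, y)" using xy \<open>y < snd p\<close> by (simp add: C_def)
        then have "real (Suc t) < slope (x, y)" using \<open>y < snd p\<close> by (subst less_slope) simp_all
        then show ?thesis using hi by simp
      qed
      then have "\<tau> * real_of_int (snd p - y) \<le> slope (x, y) * real_of_int (snd p - y)"
        using True by (intro mult_right_mono) simp_all
      also have "\<dots> = real_of_int (x - fst p)" using slope[of "(x, y)"] True by simp
      finally show ?thesis by (simp add: s_def algebra_simps)
    next
      case False
      have "level t p \<le> level t (x, y)" by (rule pmin[OF xy])
      then have "fst p + int t * snd p \<le> x + int t * y" by (simp add: level_def)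
      then have "real_of_int (fst p + int t * snd p) \<le> real_of_int (x + int t * y)" by (simp only: of_int_le_iff)
      moreover have "0 \<le> (\<tau> - real t) * (real_of_int y - real_of_int (snd p))"
        using lo False by (intro mult_nonneg_nonneg) simp_all
      ultimately show ?thesis by (simp add: s_def algebra_simps)
    qed
    have "r = p"
    proof (rule supporting_slope_integral[OF L lo hi supp rp(1) _ pL])
      show "real_of_int (fst p) + \<tau> * real_of_int (snd p) = s" by (simp add: s_def)
      show "real_of_int (fst r) + \<tau> * real_of_int (snd r) = s"
        using slope[OF rp(2)] by (simp add: s_def \<tau>_def[symmetric] algebra_simps)
    qed
    then show False using rp(2) by simp
  qed
  then show ?thesis using pL pmin q0(2) by (meson order_trans)
qed

text \<open>The common minimisers \<open>p t\<close> of consecutive functionals are the vertices: their depths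
  \<open>- snd (p t)\<close> start at \<open>0\<close>, increase, and are the differences of successive minima.  With \<open>a\<close> having
  these depths, the minima show that the set lies in the staircase of \<open>a\<close>, and the vertices together with integral
  closedness show the converse.\<close>
lemma A_imp_staircase:
  assumes L: "L \<in> \<A>"
  shows "\<exists>a. L = staircase a"
proof -
  obtain p where p: "\<And>t. p t \<in> L" "\<And>t q. q \<in> L \<Longrightarrow> level t (p t) \<le> level t q"
    "\<And>t q. q \<in> L \<Longrightarrow> level (Suc t) (p t) \<le> level (Suc t) q"
    using consecutive_minimiser[OF L] by metis
  define N where "N = (\<lambda>t. - snd (p t))"
  have eq: "level (Suc t) (p (Suc t)) = level (Suc t) (p t)" for t
    using p by (meson order_antisym)
  have step: "level (Suc t) (p (Suc t)) = level t (p t) - N t" for t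
    unfolding eq by (simp add: level_Suc N_def)
  have fst0: "fst (p 0) = 0"
    using p(2)[OF A_zero[OF L], of 0] A_fst_nonneg[OF L p(1)[of 0]] by (simp add: level_def)
  then have N0: "N 0 = 0"
    using p(3)[OF A_zero[OF L], of 0] A_axis[OF L p(1)[of 0]] by (simp add: level_def N_def)
  have Nmono: "N t \<le> N (Suc t)" for t
    using p(2)[OF p(1)[of "Suc t"], of t] eq[of t] by (simp add: level_Suc N_def)
  define a where "a = (\<lambda>j. nat (N j - N (j - 1)))"
  have depth: "depth a = N" unfolding a_def by (rule depth_surj[OF N0 Nmono])
  have support: "level t (p t) = - support a t" for t
  proof (induction t)
    case 0 then show ?case using fst0 by (simp add: level_def)
  next
    case (Suc t) then show ?case by (simp add: step depth)
  qed
  have vertex: "vertex a t = p t" for t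
    using support[of t] by (simp add: vertex_eq prod_eq_iff depth level_def N_def algebra_simps)
  have "L = staircase a"
  proof (intro subset_antisym subsetI)
    fix q assume q: "q \<in> L"
    have "0 \<le> fst q + int t * snd q + support a t" for t
      using p(2)[OF q, of t] support[of t] by (simp add: level_def)
    then show "q \<in> staircase a" by (cases q) (simp add: staircase_iff_support)
  next
    fix q assume "q \<in> staircase a"
    then have "real_point q \<in> region a" by (simp add: staircase_def)
    then have "real_point q \<in> New L"
      using region_subset_New[OF A_submodule[OF L], of a] p(1) by (auto simp: vertex)
    then show "q \<in> L" using A_integrally_closed[OF L] unfolding integrally_closed_def by blast
  qed
  then show ?thesis by blast
qed

section \<open>Recovering the sequence from finitely many lattice points\<close>

text \<open>Before the crossing index \<open>s\<close> every increment is at most \<open>- 1\<close>, so a point of the staircase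
  satisfies \<open>s \<le> x\<close>: membership involves the coefficients with index at most \<open>x\<close> only.  This is the
  continuity of the parametrisation.\<close>
lemma staircase_local_imp:
  assumes "(x, y) \<in> staircase a" and eq: "\<And>j. 1 \<le> j \<Longrightarrow> int j \<le> x \<Longrightarrow> a j = b j"
  shows "(x, y) \<in> staircase b"
proof (cases "y < 0")
  case False
  then show ?thesis
    using staircase_bounds(1)[OF assms(1)] quadrant_subset_staircase[of b] by (auto simp: quadrant_def)
next
  case True
  with assms(1) obtain s where s: "1 \<le> s" "depth a (s - 1) + y < 0" "0 \<le> depth a s + y"
    "\<And>j. j < s \<Longrightarrow> depth a j + y \<le> 0" "\<And>j. s \<le> j \<Longrightarrow> 0 \<le> depth a j + y"
    by (rule staircase_crossing) blast
  have "depth a j + y \<le> - 1" if "j < s" for j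
    using s(2) depth_mono[of j "s - 1" a] that by linarith
  then have "(\<Sum>j<s. depth a j + y) \<le> - int s"
    using sum_bounded_above[of "{..<s}" "\<lambda>j. depth a j + y" "- 1"] by simp
  moreover have mem: "0 \<le> x + (\<Sum>j<s. depth a j + y)" using assms(1) by (simp add: staircase_iff)
  ultimately have "int s \<le> x" by linarith
  then have d: "depth a j = depth b j" if "j \<le> s" for j
    using that eq by (intro depth_cong) simp
  have "depth b j + y \<le> 0" if "j < s" for j using s(4)[OF that] d[of j] that by simp
  moreover have "0 \<le> depth b j + y" if "s \<le> j" for j
    using s(3) d[of s] depth_mono[OF that, of b] by simp
  moreover have "(\<Sum>j<s. depth a j + y) = (\<Sum>j<s. depth b j + y)" by (rule sum.cong) (simp_all add: d)
  ultimately show ?thesis using mem by (subst staircase_at_crossing[of s]) simp_all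
qed

lemma staircase_local:
  assumes "\<And>j. 1 \<le> j \<Longrightarrow> int j \<le> fst p \<Longrightarrow> a j = b j"
  shows "p \<in> staircase a \<longleftrightarrow> p \<in> staircase b"
  using staircase_local_imp[of "fst p" "snd p" a b] staircase_local_imp[of "fst p" "snd p" b a] assms by auto

lemma beyond_vertex_notin_staircase: "vertex a t + (int t, - 1) \<notin> staircase a"
proof
  assume "vertex a t + (int t, - 1) \<in> staircase a"
  then have "(int t * depth a t - support a t + int t, - depth a t - 1) \<in> staircase a" by (simp add: vertex_eq)
  then have "0 \<le> int t * depth a t - support a t + int t + int (Suc t) * (- depth a t - 1) + support a (Suc t)"
    unfolding staircase_iff_support by blast
  then show False by (simp add: algebra_simps)
qed

text \<open>The first \<open>n\<close> coefficients can be read off from \<open>2 n\<close> lattice points, namely the vertices and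
  their successors in the direction of the edges: given the earlier coefficients, the vertex \<open>t\<close>
  forces \<open>a t \<le> b t\<close>, and the absence of its successor forces \<open>b t \<le> a t\<close>.  This yields
  injectivity and the continuity of the inverse.\<close>
lemma eq_if_vertices_agree:
  assumes v: "\<And>t. 1 \<le> t \<Longrightarrow> t \<le> n \<Longrightarrow> vertex a t \<in> staircase b"
    and v': "\<And>t. 1 \<le> t \<Longrightarrow> t \<le> n \<Longrightarrow> vertex a t + (int t, - 1) \<notin> staircase b"
  shows "1 \<le> t \<Longrightarrow> t \<le> n \<Longrightarrow> b t = a t"
proof (induction t rule: less_induct)
  case (less t)
  then obtain r where r: "t = Suc r" by (cases t) auto
  have d: "depth b j = depth a j" if "j < t" for j
    using that less by (intro depth_cong) simp
  have "(\<Sum>j<t. depth b j) = (\<Sum>j<t. depth a j)" by (rule sum.cong) (simp_all add: d)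
  then have h: "support b t = support a t" unfolding support_def .
  have "(int t * depth a t - support a t, - depth a t) \<in> staircase b"
    using v[OF less.prems] by (simp add: vertex_eq)
  then have "0 \<le> int t * depth a t - support a t + int (Suc t) * (- depth a t) + support b (Suc t)"
    unfolding staircase_iff_support by blast
  then have "depth a t \<le> depth b t" by (simp add: h algebra_simps)
  moreover have "\<not> depth a t < depth b t"
  proof
    assume lt: "depth a t < depth b t"
    let ?y = "- depth a t - 1"
    have "(int t * depth a t - support a t + int t, ?y) \<in> staircase b
        \<longleftrightarrow> 0 \<le> int t * depth a t - support a t + int t + (\<Sum>j<t. depth b j + ?y)"
    proof (rule staircase_at_crossing)
      show "depth b j + ?y \<le> 0" if "j < t" for j using that d[OF that] depth_mono[of j t a] by simp
      show "0 \<le> depth b j + ?y" if "t \<le> j" for j using lt depth_mono[OF that, of b] by simp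
    qed
    moreover have "(\<Sum>j<t. depth b j + ?y) = support a t + int t * ?y"
      using h by (simp add: support_def sum.distrib)
    ultimately have "(int t * depth a t - support a t + int t, ?y) \<in> staircase b"
      by (simp add: algebra_simps)
    then show False using v'[OF less.prems] by (simp add: vertex_eq)
  qed
  ultimately show ?case using d[of r] by (simp add: r)
qed

lemma staircase_eq_iff: "staircase a = staircase b \<longleftrightarrow> (\<forall>j\<ge>1. a j = b j)"
proof
  assume eq: "staircase a = staircase b"
  have "b j = a j" if "1 \<le> j" for j
    using vertex_in_staircase[of a] beyond_vertex_notin_staircase[of a] that
    unfolding eq by (intro eq_if_vertices_agree[of j a b j]) simp_all
  then show "\<forall>j\<ge>1. a j = b j" by simp
qed (use staircase_cong in blast)

section \<open>Truncations and multiplicities\<close>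

definition initial_part :: "(nat \<Rightarrow> nat) \<Rightarrow> nat \<Rightarrow> nat \<Rightarrow> nat" where
  "initial_part a n j = (if j \<le> n then a j else 0)"

lemma depth_initial_part: "depth (initial_part a n) j = depth a (min j n)"
proof (induction j)
  case (Suc j)
  show ?case
  proof (cases "Suc j \<le> n")
    case False
    then have "min (Suc j) n = n" "min j n = n" by simp_all
    then show ?thesis using Suc False by (simp add: initial_part_def)
  qed (use Suc in \<open>simp add: initial_part_def\<close>)
qed simp

lemma staircase_depth_cong: "depth a = depth b \<Longrightarrow> staircase a = staircase b"
  by (simp add: staircase_def region_def)

text \<open>Regarding \<open>a\<close> as a multiset of indices, in which \<open>j\<close> occurs \<open>a j\<close> times, this is the multiset of its
  \<open>c\<close> smallest members.\<close>
definition capped :: "(nat \<Rightarrow> nat) \<Rightarrow> nat \<Rightarrow> nat \<Rightarrow> nat" where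
  "capped a c j = nat (min (depth a j) (int c) - min (depth a (j - 1)) (int c))"

lemma depth_capped: "depth (capped a c) = (\<lambda>j. min (depth a j) (int c))"
  unfolding capped_def by (rule depth_surj) auto

text \<open>Depths capped at \<open>c\<close> leave no points below height \<open>- c\<close>.  Above that height the capped increments
  \<open>c + y\<close> are nonnegative, so the constraints altered by the cap follow from the unaltered ones.\<close>
lemma truncation_staircase: "truncation (staircase a) c = staircase (capped a c)"
proof -
  have "(x, y) \<in> truncation (staircase a) c \<longleftrightarrow> (x, y) \<in> staircase (capped a c)" for x y
  proof
    assume "(x, y) \<in> truncation (staircase a) c"
    then have mem: "0 \<le> x + (\<Sum>j<t. depth a j + y)" and y: "- int c \<le> y" for t
      by (auto simp: truncation_def staircase_iff)
    have "0 \<le> x + (\<Sum>j<t. min (depth a j) (int c) + y)" for t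
    proof (induction t)
      case 0 show ?case using mem[of 0] by simp
    next
      case (Suc t)
      show ?case
      proof (cases "depth a t \<le> int c")
        case True
        then have "min (depth a j) (int c) = depth a j" if "j \<le> t" for j
          using depth_mono[OF that, of a] by simp
        then have "(\<Sum>j<Suc t. min (depth a j) (int c) + y) = (\<Sum>j<Suc t. depth a j + y)"
          by (intro sum.cong) simp_all
        then show ?thesis using mem[of "Suc t"] by simp
      next
        case False then show ?thesis using Suc y by simp
      qed
    qed
    then show "(x, y) \<in> staircase (capped a c)" by (simp add: staircase_iff depth_capped)
  next
    assume *: "(x, y) \<in> staircase (capped a c)"
    then have mem: "0 \<le> x + (\<Sum>j<t. min (depth a j) (int c) + y)" for t
      by (simp add: staircase_iff depth_capped)
    have "- int c \<le> y" using staircase_bounds(2)[OF *] by (auto simp: depth_capped)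
    moreover have "0 \<le> x + (\<Sum>j<t. depth a j + y)" for t
    proof -
      have "(\<Sum>j<t. min (depth a j) (int c) + y) \<le> (\<Sum>j<t. depth a j + y)"
        by (intro sum_mono) simp
      then show ?thesis using mem[of t] by linarith
    qed
    ultimately show "(x, y) \<in> truncation (staircase a) c" by (simp add: truncation_def staircase_iff)
  qed
  then show ?thesis by auto
qed

lemma no_flat_segment_staircase: "no_flat_segment n (staircase a) \<longleftrightarrow> (\<forall>j>n. a j = 0)"
proof -
  have "no_flat_segment n (staircase a) \<longleftrightarrow>
      (\<nexists>t k. 1 \<le> t \<and> 0 < a t \<and> n < k \<and> outward_normal (region a) (edge a t) (-1, - real k))"
    unfolding no_flat_segment_def New_staircase finite_facet_region by blast
  also have "\<dots> \<longleftrightarrow> (\<nexists>t. 1 \<le> t \<and> 0 < a t \<and> n < t)"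
    by (simp only: outward_normal_edge cong: conj_cong) blast
  also have "\<dots> \<longleftrightarrow> (\<forall>j>n. a j = 0)"
  proof
    assume *: "\<nexists>t. 1 \<le> t \<and> 0 < a t \<and> n < t"
    show "\<forall>j>n. a j = 0"
    proof (intro allI impI)
      fix j assume "n < j"
      then show "a j = 0" using *[simplified, rule_format, of j] by simp
    qed
  qed (metis less_irrefl)
  finally show ?thesis .
qed

text \<open>Keeping \<open>c\<close> indices avoids all indices beyond \<open>n\<close> exactly if at most \<open>depth a n\<close> are kept, or if
  there are none beyond \<open>n\<close> to be met.  This identifies the admissible truncations.\<close>
lemma capped_eq_0_iff:
  "(\<forall>j>n. capped a c j = 0) \<longleftrightarrow> int c \<le> depth a n \<or> (\<forall>j>n. a j = 0)"
proof
  assume *: "\<forall>j>n. capped a c j = 0"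
  show "int c \<le> depth a n \<or> (\<forall>j>n. a j = 0)"
  proof (rule ccontr)
    assume "\<not> (int c \<le> depth a n \<or> (\<forall>j>n. a j = 0))"
    then obtain j where j: "n < j" "a j \<noteq> 0" and c: "depth a n < int c" by auto
    have "depth (capped a c) j = depth (initial_part (capped a c) n) j"
      using * by (intro depth_cong) (simp add: initial_part_def)
    then have "min (depth a j) (int c) = min (depth a n) (int c)"
      using j(1) by (simp add: depth_initial_part depth_capped)
    moreover have "depth a n < depth a j"
      using j depth_mono[of n "j - 1" a] by (cases j) auto
    ultimately show False using c by auto
  qed
next
  assume *: "int c \<le> depth a n \<or> (\<forall>j>n. a j = 0)"
  show "\<forall>j>n. capped a c j = 0"
  proof (intro allI impI)
    fix j assume j: "n < j"
    show "capped a c j = 0"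
    proof (cases "int c \<le> depth a n")
      case True
      have "depth a n \<le> depth a j" "depth a n \<le> depth a (j - 1)" using j by (auto intro: depth_mono)
      then show ?thesis using True by (simp add: capped_def)
    next
      case False
      then have "a j = 0" using * j by blast
      then show ?thesis using j by (cases j) (simp_all add: capped_def)
    qed
  qed
qed

text \<open>If some coefficient beyond \<open>n\<close> is nonzero, the largest admissible truncation is the one at depth
  \<open>depth a n\<close>; otherwise all of them are admissible.\<close>
lemma rho_staircase: "\<rho> n (staircase a) = staircase (initial_part a n)"
proof -
  let ?adm = "\<lambda>c. no_flat_segment n (truncation (staircase a) c)"
  have adm: "?adm c \<longleftrightarrow> int c \<le> depth a n \<or> (\<forall>j>n. a j = 0)" for c
    by (simp add: truncation_staircase no_flat_segment_staircase capped_eq_0_iff)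
  show ?thesis
  proof (cases "\<forall>j>n. a j = 0")
    case True
    then have "?adm c" for c using adm by blast
    then have "\<not> (\<exists>c. ?adm c \<and> (\<forall>c'. ?adm c' \<longrightarrow> c' \<le> c))" by (metis Suc_n_not_le_n)
    then have "\<rho> n (staircase a) = staircase a" unfolding \<rho>_def Let_def by (rule if_not_P)
    also have "\<dots> = staircase (initial_part a n)"
      using True by (intro staircase_cong) (simp add: initial_part_def)
    finally show ?thesis .
  next
    case False
    define c0 where "c0 = nat (depth a n)"
    have c0: "?adm c0" "\<And>c. ?adm c \<Longrightarrow> c \<le> c0"
      using adm False by (auto simp: c0_def)
    then have "(GREATEST c. ?adm c) = c0" by (intro Greatest_equality) auto
    moreover have "\<exists>c. ?adm c \<and> (\<forall>c'. ?adm c' \<longrightarrow> c' \<le> c)" using c0 by blast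
    ultimately have "\<rho> n (staircase a) = truncation (staircase a) c0" by (simp add: \<rho>_def)
    also have "\<dots> = staircase (initial_part a n)"
      unfolding truncation_staircase
    proof (rule staircase_depth_cong, rule ext)
      fix j
      show "depth (capped a c0) j = depth (initial_part a n) j"
        using depth_mono[of j n a] depth_mono[of n j a]
        by (auto simp: depth_capped depth_initial_part c0_def min_def)
    qed
    finally show ?thesis .
  qed
qed

section \<open>Finite sums of the generators\<close>

lemma comm_monoid_submodule: "comm_monoid submodule_monoid"
proof (rule comm_monoidI)
  have unit: "quadrant + L = L" if "monoid_submodule L" for L
  proof
    show "quadrant + L \<subseteq> L" using that by (simp add: monoid_submodule_def add.commute)
    have "(0, 0) \<in> quadrant" by (simp add: quadrant_def)
    show "L \<subseteq> quadrant + L"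
    proof
      fix p assume "p \<in> L"
      from set_plus_intro[OF \<open>(0, 0) \<in> quadrant\<close> this] show "p \<in> quadrant + L"
        by (simp add: zero_prod_def[symmetric])
    qed
  qed
  show "x \<otimes>\<^bsub>submodule_monoid\<^esub> y \<in> carrier submodule_monoid"
    if "x \<in> carrier submodule_monoid" "y \<in> carrier submodule_monoid" for x y
  proof -
    have "x + y + quadrant = x + (y + quadrant)" by (simp add: add.assoc)
    also have "\<dots> \<subseteq> x + y" using that by (intro set_plus_mono2) (auto simp: submodule_monoid_def monoid_submodule_def)
    finally show ?thesis by (simp add: submodule_monoid_def monoid_submodule_def)
  qed
  show "\<one>\<^bsub>submodule_monoid\<^esub> \<in> carrier submodule_monoid"
    using submodule_staircase[of "\<lambda>_. 0"] by (simp add: submodule_monoid_def quadrant_eq_staircase)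
  show "\<one>\<^bsub>submodule_monoid\<^esub> \<otimes>\<^bsub>submodule_monoid\<^esub> x = x" if "x \<in> carrier submodule_monoid" for x
    using that unit by (simp add: submodule_monoid_def)
qed (simp_all add: submodule_monoid_def ac_simps)

text \<open>A finite product depends on the carrier, and the sum is needed both among all submodules and
  inside each \<open>\<A>_upto n\<close>; hence the variable monoid.\<close>
lemma finprod_F:
  fixes G :: "(int \<times> int) set monoid"
  assumes "comm_monoid G" and mult: "mult G = (+)" and one: "one G = quadrant"
    and carrier: "\<And>j k. 1 \<le> j \<Longrightarrow> j \<le> n \<Longrightarrow> staircase (\<lambda>i. if i = j then k else 0) \<in> carrier G"
  shows "finprod G (\<lambda>j. F j [^]\<^bsub>G\<^esub> u j) {1..n} = staircase (initial_part u n)"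
proof -
  interpret comm_monoid G by fact
  have pow: "F j [^]\<^bsub>G\<^esub> (k::nat) = staircase (\<lambda>i. if i = j then k else 0)" if "1 \<le> j" for j k
  proof (induction k)
    case 0
    have "(\<lambda>i::nat. if i = j then 0 else 0::nat) = (\<lambda>_. 0)" by auto
    then show ?case by (simp add: one quadrant_eq_staircase)
  next
    case (Suc k)
    have "(\<lambda>i. (if i = j then k else 0) + (if i = j then 1 else 0)) = (\<lambda>i. if i = j then Suc k else 0)"
      by auto
    then show ?case using Suc by (simp add: mult F_eq_staircase[OF that] staircase_sum)
  qed
  have "finprod G (\<lambda>j. F j [^]\<^bsub>G\<^esub> u j) {1..m} = staircase (initial_part u m)" if "m \<le> n" for m
    using that
  proof (induction m)
    case 0
    have "staircase (initial_part u 0) = staircase (\<lambda>_. 0)" by (rule staircase_cong) (simp add: initial_part_def)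
    then show ?case by (simp add: one quadrant_eq_staircase)
  next
    case (Suc m)
    have closed: "(\<lambda>j. F j [^]\<^bsub>G\<^esub> u j) \<in> {1..Suc m} \<rightarrow> carrier G"
      using Suc.prems by (auto simp: pow carrier)
    have "finprod G (\<lambda>j. F j [^]\<^bsub>G\<^esub> u j) (insert (Suc m) {1..m})
        = F (Suc m) [^]\<^bsub>G\<^esub> u (Suc m) \<otimes>\<^bsub>G\<^esub> finprod G (\<lambda>j. F j [^]\<^bsub>G\<^esub> u j) {1..m}"
      using closed by (intro finprod_insert) auto
    also have "\<dots> = staircase (\<lambda>i. (if i = Suc m then u (Suc m) else 0) + initial_part u m i)"
      using Suc by (simp add: pow mult staircase_sum)
    also have "\<dots> = staircase (initial_part u (Suc m))"
      by (rule staircase_cong) (auto simp: initial_part_def le_Suc_eq)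
    also have "insert (Suc m) {1..m} = {1..Suc m}" by auto
    finally show ?case .
  qed
  then show ?thesis by simp
qed

lemma partial_sum_eq_staircase: "partial_sum a n = staircase (initial_part a n)"
  unfolding partial_sum_def
  by (rule finprod_F[OF comm_monoid_submodule]) (simp_all add: submodule_monoid_def submodule_staircase)

lemma w_at_staircase: "w_at (staircase a) n = restrict a {1..n}"
proof -
  have "u \<in> {1..n} \<rightarrow>\<^sub>E UNIV \<and> \<rho> n (staircase a) = partial_sum u n \<longleftrightarrow> u = restrict a {1..n}" for u
  proof
    assume u: "u \<in> {1..n} \<rightarrow>\<^sub>E UNIV \<and> \<rho> n (staircase a) = partial_sum u n"
    then have "\<forall>j\<ge>1. initial_part a n j = initial_part u n j"
      by (simp add: rho_staircase partial_sum_eq_staircase staircase_eq_iff)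
    then have "u j = a j" if "j \<in> {1..n}" for j using that by (auto simp: initial_part_def split: if_splits)
    then show "u = restrict a {1..n}"
      using u by (intro PiE_ext[of u "{1..n}" "\<lambda>_. UNIV"]) auto
  next
    assume u: "u = restrict a {1..n}"
    then have "staircase (initial_part a n) = staircase (initial_part u n)"
      by (intro staircase_cong) (simp add: initial_part_def)
    then show "u \<in> {1..n} \<rightarrow>\<^sub>E UNIV \<and> \<rho> n (staircase a) = partial_sum u n"
      using u by (auto simp: rho_staircase partial_sum_eq_staircase)
  qed
  then show ?thesis unfolding w_at_def by simp
qed

lemma w_staircase: "1 \<le> j \<Longrightarrow> w (staircase a) j = a j"
  unfolding w_def w_at_staircase by (rule the_equality) auto

section \<open>The parametrisation as a homeomorphism\<close>

lemma openin_product_discrete: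
  "openin (product_topology (\<lambda>_. discrete_topology UNIV) I) U \<longleftrightarrow>
     U \<subseteq> I \<rightarrow>\<^sub>E UNIV \<and>
     (\<forall>f\<in>U. \<exists>K. finite K \<and> K \<subseteq> I \<and> (\<forall>g\<in>I \<rightarrow>\<^sub>E UNIV. (\<forall>i\<in>K. g i = f i) \<longrightarrow> g \<in> U))"
  (is "openin ?T U \<longleftrightarrow> ?R")
proof
  assume U: "openin ?T U"
  show ?R
  proof (intro conjI ballI)
    show "U \<subseteq> I \<rightarrow>\<^sub>E UNIV" using openin_subset[OF U] by simp
    fix f assume "f \<in> U"
    then obtain V where V: "f \<in> Pi\<^sub>E I V" "finite {i. V i \<noteq> UNIV}" "Pi\<^sub>E I V \<subseteq> U"
      using product_topology_open_contains_basis[OF U \<open>f \<in> U\<close>] by auto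
    show "\<exists>K. finite K \<and> K \<subseteq> I \<and> (\<forall>g\<in>I \<rightarrow>\<^sub>E UNIV. (\<forall>i\<in>K. g i = f i) \<longrightarrow> g \<in> U)"
    proof (intro exI[of _ "I \<inter> {i. V i \<noteq> UNIV}"] conjI ballI impI)
      fix g assume g: "g \<in> I \<rightarrow>\<^sub>E UNIV" "\<forall>i\<in>I \<inter> {i. V i \<noteq> UNIV}. g i = f i"
      have "g i \<in> V i" if "i \<in> I" for i
        using that g(2) V(1) by (cases "V i = UNIV") (auto simp: PiE_iff)
      then have "g \<in> Pi\<^sub>E I V" using g(1) by (auto simp: PiE_iff)
      then show "g \<in> U" using V(3) by blast
    qed (use V(2) in auto)
  qed
next
  assume R: ?R
  show "openin ?T U"
  proof (subst openin_subopen, intro ballI)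
    fix f assume f: "f \<in> U"
    with R obtain K where K: "finite K" "K \<subseteq> I" "\<And>g. g \<in> I \<rightarrow>\<^sub>E UNIV \<Longrightarrow> (\<forall>i\<in>K. g i = f i) \<Longrightarrow> g \<in> U" by meson
    define V where "V = (\<lambda>i. if i \<in> K then {f i} else UNIV)"
    have "openin ?T (Pi\<^sub>E I V)"
    proof (rule product_topology_basis)
      have "{i. V i \<noteq> topspace (discrete_topology UNIV)} \<subseteq> K" by (auto simp: V_def)
      then show "finite {i. V i \<noteq> topspace (discrete_topology UNIV)}" using K(1) finite_subset by blast
    qed simp
    moreover have "f \<in> Pi\<^sub>E I V" using f R by (auto simp: V_def PiE_iff)
    moreover have "Pi\<^sub>E I V \<subseteq> U"
    proof
      fix g assume g: "g \<in> Pi\<^sub>E I V"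
      have "g i = f i" if "i \<in> K" for i
        using PiE_mem[OF g, of i] that K(2) by (auto simp: V_def)
      moreover have "g \<in> I \<rightarrow>\<^sub>E UNIV" using g by (auto simp: PiE_iff)
      ultimately show "g \<in> U" using K(3) by blast
    qed
    ultimately show "\<exists>T. openin ?T T \<and> f \<in> T \<and> T \<subseteq> U" by blast
  qed
qed

lemma carrier_M: "carrier \<M> = {1..} \<rightarrow>\<^sub>E UNIV"
  by (simp add: \<M>_def nat_add_monoid_def)

text \<open>A finite set of coordinates may be replaced by an initial segment.\<close>
lemma openin_M_iff:
  "openin \<M>_topology U \<longleftrightarrow> U \<subseteq> carrier \<M> \<and>
     (\<forall>a\<in>U. \<exists>n. \<forall>b\<in>carrier \<M>. (\<forall>j\<in>{1..n}. b j = a j) \<longrightarrow> b \<in> U)"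
proof -
  have "(\<exists>K. finite K \<and> K \<subseteq> {1..} \<and> (\<forall>b\<in>carrier \<M>. (\<forall>j\<in>K. b j = a j) \<longrightarrow> b \<in> U)) \<longleftrightarrow>
      (\<exists>n. \<forall>b\<in>carrier \<M>. (\<forall>j\<in>{1..n}. b j = a j) \<longrightarrow> b \<in> U)" for a :: "nat \<Rightarrow> nat"
  proof
    assume "\<exists>K. finite K \<and> K \<subseteq> {1..} \<and> (\<forall>b\<in>carrier \<M>. (\<forall>j\<in>K. b j = a j) \<longrightarrow> b \<in> U)"
    then obtain K where K: "finite K" "K \<subseteq> {1..}" "\<And>b. b \<in> carrier \<M> \<Longrightarrow> (\<forall>j\<in>K. b j = a j) \<Longrightarrow> b \<in> U"
      by blast
    have "K \<subseteq> {1..Max K}" using K(1,2) by (auto intro: Max_ge)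
    then show "\<exists>n. \<forall>b\<in>carrier \<M>. (\<forall>j\<in>{1..n}. b j = a j) \<longrightarrow> b \<in> U" using K(3) by blast
  next
    assume "\<exists>n. \<forall>b\<in>carrier \<M>. (\<forall>j\<in>{1..n}. b j = a j) \<longrightarrow> b \<in> U"
    then obtain n where "\<forall>b\<in>carrier \<M>. (\<forall>j\<in>{1..n}. b j = a j) \<longrightarrow> b \<in> U" ..
    then show "\<exists>K. finite K \<and> K \<subseteq> {1..} \<and> (\<forall>b\<in>carrier \<M>. (\<forall>j\<in>K. b j = a j) \<longrightarrow> b \<in> U)"
      by (intro exI[of _ "{1..n}"]) auto
  qed
  then show ?thesis unfolding \<M>_topology_def openin_product_discrete carrier_M by simp
qed

lemma topspace_M: "topspace \<M>_topology = carrier \<M>"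
  by (simp add: \<M>_topology_def carrier_M)

lemma openin_M_cylinder: "openin \<M>_topology {b \<in> carrier \<M>. \<forall>j\<in>{1..n}. b j = a j}"
  unfolding openin_M_iff by (auto intro!: exI[of _ n])

lemma topspace_A: "topspace \<A>_topology = \<A>"
  by (auto simp: \<A>_topology_def topspace_pullback_topology)

text \<open>Neighbourhoods in \<open>\<A>\<close> are given by fixing the membership of finitely many lattice points.\<close>
lemma openin_A_iff:
  "openin \<A>_topology U \<longleftrightarrow> U \<subseteq> \<A> \<and>
     (\<forall>L\<in>U. \<exists>K. finite K \<and> (\<forall>L'\<in>\<A>. (\<forall>p\<in>K. p \<in> L' \<longleftrightarrow> p \<in> L) \<longrightarrow> L' \<in> U))"
  (is "_ \<longleftrightarrow> ?R")
proof
  let ?i = "\<lambda>L. indicator L :: int \<times> int \<Rightarrow> int"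
  have ind: "indicator L p = (indicator L' p :: int) \<longleftrightarrow> (p \<in> L \<longleftrightarrow> p \<in> L')"
    for p :: "int \<times> int" and L L' by (auto simp: indicator_def)
  {
    assume "openin \<A>_topology U"
    then obtain V where V: "openin (product_topology (\<lambda>_. discrete_topology UNIV) UNIV) V" "U = ?i -` V \<inter> \<A>"
      unfolding \<A>_topology_def openin_pullback_topology by blast
    show ?R
    proof (intro conjI ballI)
      fix L assume "L \<in> U"
      then have "?i L \<in> V" using V by blast
      with V(1) obtain K where K: "finite K" "\<And>g. (\<forall>p\<in>K. g p = ?i L p) \<Longrightarrow> g \<in> V"
        unfolding openin_product_discrete by auto
      have "L' \<in> U" if "L' \<in> \<A>" "\<forall>p\<in>K. p \<in> L' \<longleftrightarrow> p \<in> L" for L'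
        using that K(2)[of "?i L'"] unfolding V(2) ind by blast
      then show "\<exists>K. finite K \<and> (\<forall>L'\<in>\<A>. (\<forall>p\<in>K. p \<in> L' \<longleftrightarrow> p \<in> L) \<longrightarrow> L' \<in> U)"
        using K(1) by blast
    qed (use V in blast)
  }
  {
    assume R: ?R
    define V where "V = {g. \<exists>L K. finite K \<and> (\<forall>L'\<in>\<A>. (\<forall>p\<in>K. p \<in> L' \<longleftrightarrow> p \<in> L) \<longrightarrow> L' \<in> U)
        \<and> (\<forall>p\<in>K. g p = ?i L p)}"
    have "openin (product_topology (\<lambda>_. discrete_topology UNIV) UNIV) V"
      unfolding openin_product_discrete
    proof (intro conjI ballI)
      fix g assume "g \<in> V"
      then obtain L K where LK: "finite K" "\<forall>L'\<in>\<A>. (\<forall>p\<in>K. p \<in> L' \<longleftrightarrow> p \<in> L) \<longrightarrow> L' \<in> U"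
        "\<forall>p\<in>K. g p = ?i L p" unfolding V_def by blast
      have "h \<in> V" if "\<forall>p\<in>K. h p = g p" for h
        unfolding V_def mem_Collect_eq using LK that by (intro exI[of _ L] exI[of _ K]) simp
      then show "\<exists>K. finite K \<and> K \<subseteq> UNIV \<and> (\<forall>h\<in>UNIV \<rightarrow>\<^sub>E UNIV. (\<forall>p\<in>K. h p = g p) \<longrightarrow> h \<in> V)"
        using LK(1) by blast
    qed auto
    moreover have "U = ?i -` V \<inter> \<A>"
    proof (intro subset_antisym subsetI)
      fix L assume "L \<in> U"
      then show "L \<in> ?i -` V \<inter> \<A>" using R unfolding V_def by blast
    next
      fix L assume "L \<in> ?i -` V \<inter> \<A>"
      then obtain L0 K where "L \<in> \<A>" "\<forall>L'\<in>\<A>. (\<forall>p\<in>K. p \<in> L' \<longleftrightarrow> p \<in> L0) \<longrightarrow> L' \<in> U"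
        and "\<forall>p\<in>K. ?i L p = ?i L0 p"
        unfolding V_def by blast
      then show "L \<in> U" by (simp only: ind)
    qed
    ultimately show "openin \<A>_topology U"
      unfolding \<A>_topology_def openin_pullback_topology by blast
  }
qed

lemma A_cases:
  assumes "L \<in> \<A>"
  obtains a where "a \<in> carrier \<M>" "L = staircase a"
proof -
  obtain a where "L = staircase a" using A_imp_staircase[OF assms] by blast
  also have "staircase a = staircase (restrict a {1..})" by (rule staircase_cong) simp
  finally show thesis by (intro that[of "restrict a {1..}"]) (auto simp: carrier_M)
qed

lemma inj_on_staircase: "inj_on staircase (carrier \<M>)"
proof (rule inj_onI)
  fix a b assume "a \<in> carrier \<M>" "b \<in> carrier \<M>" "staircase a = staircase b"
  then show "a = b"
    by (intro PiE_ext[of a "{1..}" "\<lambda>_. UNIV" b]) (auto simp: carrier_M staircase_eq_iff)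
qed

lemma image_staircase: "staircase ` carrier \<M> = \<A>"
  using A_cases staircase_in_A by blast

text \<open>Continuity is the locality of membership, openness the recovery of coefficients from finitely
  many points.\<close>
lemma homeomorphic_map_staircase: "homeomorphic_map \<M>_topology \<A>_topology staircase"
proof (rule bijective_open_imp_homeomorphic_map)
  show "staircase ` topspace \<M>_topology = topspace \<A>_topology"
    by (simp add: topspace_M topspace_A image_staircase)
  show "inj_on staircase (topspace \<M>_topology)"
    by (simp add: topspace_M inj_on_staircase)
  show "continuous_map \<M>_topology \<A>_topology staircase"
    unfolding continuous_map_def
  proof (intro conjI allI impI)
    fix U assume U: "openin \<A>_topology U"
    show "openin \<M>_topology {a \<in> topspace \<M>_topology. staircase a \<in> U}"
      unfolding openin_M_iff
    proof (intro conjI ballI)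
      fix a assume "a \<in> {a \<in> topspace \<M>_topology. staircase a \<in> U}"
      then have "staircase a \<in> U" by simp
      with U obtain K where K: "finite K"
        "\<And>L'. L' \<in> \<A> \<Longrightarrow> (\<forall>p\<in>K. p \<in> L' \<longleftrightarrow> p \<in> staircase a) \<Longrightarrow> L' \<in> U"
        unfolding openin_A_iff by meson
      define n where "n = Max (insert 0 ((\<lambda>p. nat (fst p)) ` K))"
      have n: "nat (fst p) \<le> n" if "p \<in> K" for p
        unfolding n_def using that K(1) by (intro Max_ge) auto
      have "staircase b \<in> U" if "\<forall>j\<in>{1..n}. b j = a j" for b
      proof (rule K(2)[OF staircase_in_A], rule ballI)
        fix p assume "p \<in> K"
        from n[OF this] show "p \<in> staircase b \<longleftrightarrow> p \<in> staircase a"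
          using that by (intro staircase_local) auto
      qed
      then show "\<exists>n. \<forall>b\<in>carrier \<M>. (\<forall>j\<in>{1..n}. b j = a j) \<longrightarrow> b \<in> {a \<in> topspace \<M>_topology. staircase a \<in> U}"
        by (auto simp: topspace_M)
    qed (auto simp: topspace_M)
  qed (auto simp: topspace_A staircase_in_A)
  show "open_map \<M>_topology \<A>_topology staircase"
    unfolding open_map_def
  proof (intro allI impI)
    fix U assume U: "openin \<M>_topology U"
    show "openin \<A>_topology (staircase ` U)"
      unfolding openin_A_iff
    proof (intro conjI ballI)
      fix L assume "L \<in> staircase ` U"
      then obtain a where a: "a \<in> U" "L = staircase a" by blast
      with U obtain n where n: "\<And>b. b \<in> carrier \<M> \<Longrightarrow> (\<forall>j\<in>{1..n}. b j = a j) \<Longrightarrow> b \<in> U"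
        unfolding openin_M_iff by meson
      define K where "K = vertex a ` {1..n} \<union> (\<lambda>t. vertex a t + (int t, - 1)) ` {1..n}"
      have "L' \<in> staircase ` U" if L': "L' \<in> \<A>" "\<forall>p\<in>K. p \<in> L' \<longleftrightarrow> p \<in> L" for L'
      proof -
        obtain b where b: "b \<in> carrier \<M>" "L' = staircase b" using L'(1) by (rule A_cases)
        have "b t = a t" if "1 \<le> t" "t \<le> n" for t
        proof (rule eq_if_vertices_agree[OF _ _ that])
          fix t assume "1 \<le> t" "t \<le> n"
          then have "vertex a t \<in> K" "vertex a t + (int t, - 1) \<in> K" by (auto simp: K_def)
          then show "vertex a t \<in> staircase b" "vertex a t + (int t, - 1) \<notin> staircase b"
            using L'(2) vertex_in_staircase[of a t] beyond_vertex_notin_staircase[of a t]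
            unfolding a(2) b(2) by blast+
        qed
        then have "b \<in> U" using b(1) n by simp
        then show ?thesis using b(2) by blast
      qed
      moreover have "finite K" by (simp add: K_def)
      ultimately show "\<exists>K. finite K \<and> (\<forall>L'\<in>\<A>. (\<forall>p\<in>K. p \<in> L' \<longleftrightarrow> p \<in> L) \<longrightarrow> L' \<in> staircase ` U)"
        by blast
    qed (use staircase_in_A in blast)
  qed
qed

text \<open>Limits in \<open>\<A>\<close> must be unique for the definite description in \<open>\<eta>\<close> to denote.\<close>
lemma Hausdorff_A: "Hausdorff_space \<A>_topology"
proof -
  have "Hausdorff_space \<M>_topology"
    unfolding \<M>_topology_def by (simp add: Hausdorff_space_product_topology)
  then show ?thesis
    using homeomorphic_map_imp_homeomorphic_space[OF homeomorphic_map_staircase]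
      homeomorphic_Hausdorff_space by blast
qed

lemma limitin_partial_sum: "limitin \<A>_topology (partial_sum a) (staircase a) sequentially"
  unfolding limitin_def
proof (intro conjI allI impI)
  show "staircase a \<in> topspace \<A>_topology" by (simp add: topspace_A staircase_in_A)
  fix U assume U: "openin \<A>_topology U \<and> staircase a \<in> U"
  then obtain K where K: "finite K"
    "\<And>L'. L' \<in> \<A> \<Longrightarrow> (\<forall>p\<in>K. p \<in> L' \<longleftrightarrow> p \<in> staircase a) \<Longrightarrow> L' \<in> U"
    unfolding openin_A_iff by meson
  define n where "n = Max (insert 0 ((\<lambda>p. nat (fst p)) ` K))"
  have n: "nat (fst p) \<le> n" if "p \<in> K" for p
    unfolding n_def using that K(1) by (intro Max_ge) auto
  have "partial_sum a m \<in> U" if "n \<le> m" for m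
    unfolding partial_sum_eq_staircase
  proof (rule K(2)[OF staircase_in_A], rule ballI)
    fix p assume "p \<in> K"
    from n[OF this] show "p \<in> staircase (initial_part a m) \<longleftrightarrow> p \<in> staircase a"
      using that by (intro staircase_local) (auto simp: initial_part_def)
  qed
  then show "\<forall>\<^sub>F m in sequentially. partial_sum a m \<in> U"
    unfolding eventually_sequentially by blast
qed

lemma eta_eq_staircase: "\<eta> = staircase"
proof
  fix a
  have "L = staircase a" if "limitin \<A>_topology (partial_sum a) L sequentially" for L
    by (rule limitin_Hausdorff_unique[OF that limitin_partial_sum trivial_limit_sequentially Hausdorff_A])
  then show "\<eta> a = staircase a"
    unfolding \<eta>_def by (intro the_equality limitin_partial_sum)
qed

section \<open>The parametrisation as an isomorphism of topological monoids\<close>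

lemma comm_monoid_restrict_carrier:
  assumes "comm_monoid G" "C \<subseteq> carrier G" "\<one>\<^bsub>G\<^esub> \<in> C" "\<And>x y. x \<in> C \<Longrightarrow> y \<in> C \<Longrightarrow> x \<otimes>\<^bsub>G\<^esub> y \<in> C"
  shows "comm_monoid (G\<lparr>carrier := C\<rparr>)"
proof -
  interpret comm_monoid G by fact
  show ?thesis
    using assms(2-) by (intro comm_monoidI) (auto simp: m_assoc subset_iff intro: m_comm)
qed

lemma M_simps: "x \<otimes>\<^bsub>\<M>\<^esub> y = (\<lambda>j\<in>{1..}. x j + y j)" "\<one>\<^bsub>\<M>\<^esub> = (\<lambda>j\<in>{1..}. 0)"
  by (simp_all add: \<M>_def nat_add_monoid_def)

lemma comm_monoid_M: "comm_monoid \<M>"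
proof (rule comm_monoidI)
  fix x y z assume "x \<in> carrier \<M>" "y \<in> carrier \<M>" "z \<in> carrier \<M>"
  show "x \<otimes>\<^bsub>\<M>\<^esub> y \<otimes>\<^bsub>\<M>\<^esub> z = x \<otimes>\<^bsub>\<M>\<^esub> (y \<otimes>\<^bsub>\<M>\<^esub> z)"
    by (auto simp: M_simps add.assoc intro!: restrict_ext)
next
  fix x y assume "x \<in> carrier \<M>" "y \<in> carrier \<M>"
  show "x \<otimes>\<^bsub>\<M>\<^esub> y \<in> carrier \<M>" by (simp add: M_simps carrier_M)
  show "x \<otimes>\<^bsub>\<M>\<^esub> y = y \<otimes>\<^bsub>\<M>\<^esub> x" by (simp add: M_simps add.commute)
next
  fix x assume "x \<in> carrier \<M>"
  then show "\<one>\<^bsub>\<M>\<^esub> \<otimes>\<^bsub>\<M>\<^esub> x = x"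
    by (intro PiE_ext[of _ "{1..}" "\<lambda>_. UNIV"]) (auto simp: M_simps carrier_M)
qed (simp add: M_simps carrier_M)

lemma comm_monoid_M_upto: "comm_monoid (\<M>_upto n)"
  unfolding \<M>_upto_def
proof (rule comm_monoid_restrict_carrier[OF comm_monoid_M])
  show "\<one>\<^bsub>\<M>\<^esub> \<in> {a \<in> carrier \<M>. \<forall>j>n. a j = 0}" by (simp add: M_simps carrier_M)
  show "x \<otimes>\<^bsub>\<M>\<^esub> y \<in> {a \<in> carrier \<M>. \<forall>j>n. a j = 0}"
    if "x \<in> {a \<in> carrier \<M>. \<forall>j>n. a j = 0}" "y \<in> {a \<in> carrier \<M>. \<forall>j>n. a j = 0}" for x y
    using that by (simp add: M_simps carrier_M)
qed auto

lemma staircase_mult: "staircase (x \<otimes>\<^bsub>\<M>\<^esub> y) = staircase x + staircase y"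
  unfolding staircase_sum by (rule staircase_cong) (simp add: M_simps)

lemma A_upto_eq: "\<A>_upto n = staircase ` carrier (\<M>_upto n)"
proof (intro subset_antisym subsetI)
  fix L assume L: "L \<in> \<A>_upto n"
  then have "L \<in> \<A>" by (simp add: \<A>_upto_def)
  then obtain a where a: "a \<in> carrier \<M>" "L = staircase a" by (rule A_cases)
  then show "L \<in> staircase ` carrier (\<M>_upto n)"
    using L by (auto simp: \<M>_upto_def staircase_in_A_upto_iff)
qed (auto simp: \<M>_upto_def staircase_in_A_upto_iff)

lemma comm_monoid_A: "comm_monoid \<A>_monoid"
  unfolding \<A>_monoid_def
proof (rule comm_monoid_restrict_carrier[OF comm_monoid_submodule])
  show "\<A> \<subseteq> carrier submodule_monoid" using A_submodule by (auto simp: submodule_monoid_def)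
  show "\<one>\<^bsub>submodule_monoid\<^esub> \<in> \<A>" by (simp add: submodule_monoid_def quadrant_eq_staircase staircase_in_A)
  show "x \<otimes>\<^bsub>submodule_monoid\<^esub> y \<in> \<A>" if "x \<in> \<A>" "y \<in> \<A>" for x y
    using that by (auto simp: submodule_monoid_def staircase_sum staircase_in_A elim!: A_cases)
qed

lemma carrier_A_upto: "carrier (\<A>_upto_monoid n) = \<A>_upto n"
  by (simp add: \<A>_upto_monoid_def)

lemma comm_monoid_A_upto: "comm_monoid (\<A>_upto_monoid n)"
  unfolding \<A>_upto_monoid_def
proof (rule comm_monoid_restrict_carrier[OF comm_monoid_submodule])
  show "\<A>_upto n \<subseteq> carrier submodule_monoid"
    using A_submodule by (auto simp: submodule_monoid_def \<A>_upto_def)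
  show "\<one>\<^bsub>submodule_monoid\<^esub> \<in> \<A>_upto n"
    by (simp add: submodule_monoid_def quadrant_eq_staircase staircase_in_A_upto_iff)
  show "x \<otimes>\<^bsub>submodule_monoid\<^esub> y \<in> \<A>_upto n" if xy: "x \<in> \<A>_upto n" "y \<in> \<A>_upto n" for x y
  proof -
    obtain a b where ab: "a \<in> carrier (\<M>_upto n)" "x = staircase a" "b \<in> carrier (\<M>_upto n)" "y = staircase b"
      using xy unfolding A_upto_eq by blast
    then have "staircase (\<lambda>j. a j + b j) \<in> \<A>_upto n"
      unfolding staircase_in_A_upto_iff by (simp add: \<M>_upto_def)
    then show ?thesis by (simp add: ab submodule_monoid_def staircase_sum)
  qed
qed

lemma iso_staircase: "staircase \<in> iso \<M> \<A>_monoid"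
  unfolding iso_def hom_def bij_betw_def
  by (simp add: \<A>_monoid_def inj_on_staircase image_staircase staircase_in_A staircase_mult submodule_monoid_def)

lemma iso_staircase_upto: "staircase \<in> iso (\<M>_upto n) (\<A>_upto_monoid n)"
proof -
  have "inj_on staircase (carrier (\<M>_upto n))"
    using inj_on_staircase by (rule inj_on_subset) (auto simp: \<M>_upto_def)
  moreover have "staircase (x \<otimes>\<^bsub>\<M>_upto n\<^esub> y) = staircase x + staircase y" for x y
    using staircase_mult by (simp add: \<M>_upto_def)
  ultimately show ?thesis
    unfolding iso_def hom_def bij_betw_def
    by (auto simp: \<A>_upto_monoid_def A_upto_eq submodule_monoid_def)
qed

lemma topological_monoid_transport:
  assumes G: "topological_monoid G S" and h: "h \<in> iso G H" and H: "Group.monoid H"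
    and hom: "homeomorphic_map S T h"
  shows "topological_monoid H T"
proof -
  have S: "topspace S = carrier G"
    and cont: "continuous_map (prod_topology S S) S (\<lambda>(x, y). x \<otimes>\<^bsub>G\<^esub> y)"
    using G by (auto simp: topological_monoid_def)
  obtain g where g: "homeomorphic_maps S T h g" using hom by (auto simp: homeomorphic_map_maps)
  have gc: "continuous_map T S g" and hc: "continuous_map S T h"
    and hg: "\<And>y. y \<in> topspace T \<Longrightarrow> h (g y) = y"
    using g by (auto simp: homeomorphic_maps_def)
  have T: "topspace T = carrier H"
    using homeomorphic_imp_surjective_map[OF hom] h by (simp add: S iso_def bij_betw_def)
  have "continuous_map (prod_topology T T) (prod_topology S S) (\<lambda>(x, y). (g x, g y))"
    using gc by (simp add: continuous_map_prod_top)
  from continuous_map_compose[OF continuous_map_compose[OF this cont] hc]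
  have "continuous_map (prod_topology T T) T (h \<circ> ((\<lambda>(x, y). x \<otimes>\<^bsub>G\<^esub> y) \<circ> (\<lambda>(x, y). (g x, g y))))" .
  moreover have "(h \<circ> ((\<lambda>(x, y). x \<otimes>\<^bsub>G\<^esub> y) \<circ> (\<lambda>(x, y). (g x, g y)))) p = (\<lambda>(x, y). x \<otimes>\<^bsub>H\<^esub> y) p"
    if p_in: "p \<in> topspace (prod_topology T T)" for p
  proof -
    obtain x y where p: "p = (x, y)" "x \<in> topspace T" "y \<in> topspace T" using p_in by auto
    then have "g x \<in> carrier G" "g y \<in> carrier G"
      using gc S by (auto simp: continuous_map_def)
    then have "h (g x \<otimes>\<^bsub>G\<^esub> g y) = h (g x) \<otimes>\<^bsub>H\<^esub> h (g y)" using h by (simp add: iso_def hom_def)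
    then show ?thesis using p hg by simp
  qed
  ultimately have "continuous_map (prod_topology T T) T (\<lambda>(x, y). x \<otimes>\<^bsub>H\<^esub> y)"
    by (rule continuous_map_eq)
  then show ?thesis using H T by (simp add: topological_monoid_def)
qed

lemma topological_monoid_discrete:
  assumes "Group.monoid G"
  shows "topological_monoid G (discrete_topology (carrier G))"
  using assms monoid.m_closed[OF assms]
  by (auto simp: topological_monoid_def simp flip: prod_topology_discrete_topology)

lemma topological_monoid_M: "topological_monoid \<M> \<M>_topology"
proof -
  have "openin (prod_topology \<M>_topology \<M>_topology)
      {p \<in> topspace (prod_topology \<M>_topology \<M>_topology). (\<lambda>(x, y). x \<otimes>\<^bsub>\<M>\<^esub> y) p \<in> U}"
    if U: "openin \<M>_topology U" for U
    unfolding openin_prod_topology_alt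
  proof (intro allI impI)
    fix x y
    assume "(x, y) \<in> {p \<in> topspace (prod_topology \<M>_topology \<M>_topology). (\<lambda>(x, y). x \<otimes>\<^bsub>\<M>\<^esub> y) p \<in> U}"
    then have xy: "x \<in> carrier \<M>" "y \<in> carrier \<M>" "x \<otimes>\<^bsub>\<M>\<^esub> y \<in> U" by (simp_all add: topspace_M)
    with U obtain n where n: "\<And>b. b \<in> carrier \<M> \<Longrightarrow> (\<forall>j\<in>{1..n}. b j = (x \<otimes>\<^bsub>\<M>\<^esub> y) j) \<Longrightarrow> b \<in> U"
      unfolding openin_M_iff by meson
    let ?C = "\<lambda>x. {b \<in> carrier \<M>. \<forall>j\<in>{1..n}. b j = x j}"
    have "?C x \<times> ?C y \<subseteq> {p \<in> topspace (prod_topology \<M>_topology \<M>_topology). (\<lambda>(x, y). x \<otimes>\<^bsub>\<M>\<^esub> y) p \<in> U}"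
    proof safe
      fix b c assume bc: "b \<in> carrier \<M>" "c \<in> carrier \<M>" "\<forall>j\<in>{1..n}. b j = x j" "\<forall>j\<in>{1..n}. c j = y j"
      then have "b \<otimes>\<^bsub>\<M>\<^esub> c \<in> carrier \<M>" by (simp add: M_simps carrier_M)
      then show "b \<otimes>\<^bsub>\<M>\<^esub> c \<in> U" using bc by (intro n) (simp_all add: M_simps)
      show "(b, c) \<in> topspace (prod_topology \<M>_topology \<M>_topology)" using bc by (simp add: topspace_M)
    qed
    then show "\<exists>V W. openin \<M>_topology V \<and> openin \<M>_topology W \<and> x \<in> V \<and> y \<in> W \<and>
        V \<times> W \<subseteq> {p \<in> topspace (prod_topology \<M>_topology \<M>_topology). (\<lambda>(x, y). x \<otimes>\<^bsub>\<M>\<^esub> y) p \<in> U}"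
      using openin_M_cylinder[of n x] openin_M_cylinder[of n y] xy
      by (intro exI[of _ "?C x"] exI[of _ "?C y"]) simp
  qed
  then have "continuous_map (prod_topology \<M>_topology \<M>_topology) \<M>_topology (\<lambda>(x, y). x \<otimes>\<^bsub>\<M>\<^esub> y)"
    by (auto simp: continuous_map_def topspace_M M_simps carrier_M)
  then show ?thesis
    using comm_monoid_M by (simp add: topological_monoid_def topspace_M comm_monoid_def)
qed

lemma M_upto_discrete:
  "subtopology \<M>_topology (carrier (\<M>_upto n)) = discrete_topology (carrier (\<M>_upto n))"
proof (rule sym, unfold discrete_topology_unique, intro conjI ballI)
  have sub: "carrier (\<M>_upto n) \<subseteq> carrier \<M>" by (auto simp: \<M>_upto_def)
  then show "topspace (subtopology \<M>_topology (carrier (\<M>_upto n))) = carrier (\<M>_upto n)"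
    by (auto simp: topspace_M)
  fix a assume a: "a \<in> carrier (\<M>_upto n)"
  have "b = a" if "b \<in> carrier (\<M>_upto n)" "\<forall>j\<in>{1..n}. b j = a j" for b
  proof (rule PiE_ext)
    show "b \<in> {1..} \<rightarrow>\<^sub>E UNIV" "a \<in> {1..} \<rightarrow>\<^sub>E UNIV" using that a sub carrier_M by auto
    fix j assume "j \<in> {1::nat..}"
    then show "b j = a j" using that a by (cases "j \<le> n") (auto simp: \<M>_upto_def)
  qed
  then have "{a} = {b \<in> carrier \<M>. \<forall>j\<in>{1..n}. b j = a j} \<inter> carrier (\<M>_upto n)"
    using a sub by blast
  then show "openin (subtopology \<M>_topology (carrier (\<M>_upto n))) {a}"
    unfolding openin_subtopology using openin_M_cylinder by blast
qed

lemma homeomorphic_map_staircase_upto: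
  "homeomorphic_map (subtopology \<M>_topology (carrier (\<M>_upto n))) (\<A>_upto_topology n) staircase"
  unfolding \<A>_upto_topology_def
proof (rule homeomorphic_map_subtopologies[OF homeomorphic_map_staircase])
  have "carrier \<M> \<inter> carrier (\<M>_upto n) = carrier (\<M>_upto n)" by (auto simp: \<M>_upto_def)
  moreover have "\<A> \<inter> \<A>_upto n = \<A>_upto n" by (auto simp: \<A>_upto_def)
  ultimately show "staircase ` (topspace \<M>_topology \<inter> carrier (\<M>_upto n)) = topspace \<A>_topology \<inter> \<A>_upto n"
    by (simp add: topspace_M topspace_A A_upto_eq)
qed

lemma A_upto_discrete: "\<A>_upto_topology n = discrete_topology (\<A>_upto n)"
proof (rule sym, unfold discrete_topology_unique, intro conjI ballI)
  show "topspace (\<A>_upto_topology n) = \<A>_upto n"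
    by (auto simp: \<A>_upto_topology_def topspace_A \<A>_upto_def)
  fix L assume "L \<in> \<A>_upto n"
  then obtain a where a: "a \<in> carrier (\<M>_upto n)" "L = staircase a" unfolding A_upto_eq by blast
  have "open_map (discrete_topology (carrier (\<M>_upto n))) (\<A>_upto_topology n) staircase"
    using homeomorphic_imp_open_map[OF homeomorphic_map_staircase_upto[of n]] by (simp add: M_upto_discrete)
  then have "openin (\<A>_upto_topology n) (staircase ` {a})"
    using a(1) unfolding open_map_def openin_discrete_topology by blast
  then show "openin (\<A>_upto_topology n) {L}" by (simp add: a(2))
qed

section \<open>Freeness\<close>

text \<open>The exponents in the definition of freeness are indexed by the basis elements, those of a sequence
  by positions \<open>1, \<dots>, n\<close>; reindexing along an enumeration \<open>e\<close> of the basis translates between them.\<close>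
lemma free_comm_monoid_if_coordinates:
  fixes e :: "nat \<Rightarrow> 'a"
  assumes "comm_monoid G" "e \<in> {1..n} \<rightarrow> carrier G" and inj: "inj_on e {1..n}"
    and unique: "\<And>x. x \<in> carrier G \<Longrightarrow>
      \<exists>!u. u \<in> {1..n} \<rightarrow>\<^sub>E (UNIV :: nat set) \<and> x = finprod G (\<lambda>j. e j [^]\<^bsub>G\<^esub> u j) {1..n}"
  shows "free_comm_monoid_finite_rank G"
  unfolding free_comm_monoid_finite_rank_def
proof (intro conjI exI[of _ "e ` {1..n}"] ballI)
  interpret comm_monoid G by fact
  have reindex: "finprod G (\<lambda>b. b [^]\<^bsub>G\<^esub> f b) (e ` {1..n}) = finprod G (\<lambda>j. e j [^]\<^bsub>G\<^esub> (restrict (f \<circ> e) {1..n}) j) {1..n}"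
    for f :: "'a \<Rightarrow> nat"
  proof -
    have "finprod G (\<lambda>b. b [^]\<^bsub>G\<^esub> f b) (e ` {1..n}) = finprod G (\<lambda>j. e j [^]\<^bsub>G\<^esub> f (e j)) {1..n}"
      using assms(2) inj by (intro finprod_reindex) auto
    also have "\<dots> = finprod G (\<lambda>j. e j [^]\<^bsub>G\<^esub> (restrict (f \<circ> e) {1..n}) j) {1..n}"
      using assms(2) by (intro finprod_cong') auto
    finally show ?thesis .
  qed
  fix x assume "x \<in> carrier G"
  from unique[OF this] obtain u :: "nat \<Rightarrow> nat" where
    "u \<in> {1..n} \<rightarrow>\<^sub>E UNIV \<and> x = finprod G (\<lambda>j. e j [^]\<^bsub>G\<^esub> u j) {1..n}" and
    u_unique: "\<forall>u'. u' \<in> {1..n} \<rightarrow>\<^sub>E UNIV \<and> x = finprod G (\<lambda>j. e j [^]\<^bsub>G\<^esub> u' j) {1..n} \<longrightarrow> u' = u"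
    by (rule ex1E)
  then have u: "u \<in> {1..n} \<rightarrow>\<^sub>E UNIV" "x = finprod G (\<lambda>j. e j [^]\<^bsub>G\<^esub> u j) {1..n}" by blast+
  define f where "f = restrict (u \<circ> inv_into {1..n} e) (e ` {1..n})"
  have fu: "restrict (f \<circ> e) {1..n} = u"
    using u(1) by (intro PiE_ext[of _ "{1..n}" "\<lambda>_. UNIV"]) (auto simp: f_def inv_into_f_f[OF inj] simp del: atLeastAtMost_iff One_nat_def)
  show "\<exists>!f. f \<in> e ` {1..n} \<rightarrow>\<^sub>E (UNIV :: nat set) \<and> x = finprod G (\<lambda>b. b [^]\<^bsub>G\<^esub> f b) (e ` {1..n})"
  proof (intro ex1I[of _ f] conjI)
    show "f \<in> e ` {1..n} \<rightarrow>\<^sub>E UNIV" by (auto simp: f_def)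
    show "x = finprod G (\<lambda>b. b [^]\<^bsub>G\<^esub> f b) (e ` {1..n})" unfolding reindex fu by (rule u(2))
    fix f' :: "'a \<Rightarrow> nat" assume f': "f' \<in> e ` {1..n} \<rightarrow>\<^sub>E UNIV \<and> x = finprod G (\<lambda>b. b [^]\<^bsub>G\<^esub> f' b) (e ` {1..n})"
    then have "restrict (f' \<circ> e) {1..n} = restrict (f \<circ> e) {1..n}"
      unfolding reindex fu by (intro u_unique[rule_format]) auto
    then have eq: "f' (e j) = f (e j)" if "j \<in> {1..n}" for j
      using that by (metis comp_apply restrict_apply')
    show "f' = f"
    proof (rule PiE_ext)
      show "f' \<in> e ` {1..n} \<rightarrow>\<^sub>E UNIV" "f \<in> e ` {1..n} \<rightarrow>\<^sub>E UNIV" using f' by (auto simp: f_def)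
    qed (use eq in blast)
  qed
qed (use assms in auto)

lemma hom_finprod_pow:
  assumes "comm_monoid G" "comm_monoid H" and h: "h \<in> hom G H" "h \<one>\<^bsub>G\<^esub> = \<one>\<^bsub>H\<^esub>"
    and "finite J" "e \<in> J \<rightarrow> carrier G"
  shows "h (finprod G (\<lambda>j. e j [^]\<^bsub>G\<^esub> (u j :: nat)) J) = finprod H (\<lambda>j. h (e j) [^]\<^bsub>H\<^esub> u j) J"
proof -
  interpret G: comm_monoid G by fact
  interpret H: comm_monoid H by fact
  have pow: "h (x [^]\<^bsub>G\<^esub> k) = h x [^]\<^bsub>H\<^esub> k" if "x \<in> carrier G" for x and k :: nat
    using that h by (induction k) (simp_all add: hom_mult)
  show ?thesis
    using assms(5,6)
  proof (induction J rule: finite_induct)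
    case empty then show ?case using h(2) by simp
  next
    case (insert j J)
    have "h (finprod G (\<lambda>j. e j [^]\<^bsub>G\<^esub> u j) (insert j J))
        = h (e j [^]\<^bsub>G\<^esub> u j \<otimes>\<^bsub>G\<^esub> finprod G (\<lambda>j. e j [^]\<^bsub>G\<^esub> u j) J)"
      using insert by (subst G.finprod_insert) auto
    also have "\<dots> = h (e j) [^]\<^bsub>H\<^esub> u j \<otimes>\<^bsub>H\<^esub> finprod H (\<lambda>j. h (e j) [^]\<^bsub>H\<^esub> u j) J"
      using insert h(1) by (subst hom_mult[OF h(1)]) (auto simp: pow intro!: G.finprod_closed)
    also have "\<dots> = finprod H (\<lambda>j. h (e j) [^]\<^bsub>H\<^esub> u j) (insert j J)"
      using insert h(1) by (subst H.finprod_insert) (auto simp: hom_def)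
    finally show ?case .
  qed
qed

lemma A_upto_coordinates:
  assumes "a \<in> carrier (\<M>_upto n)"
  shows "\<exists>!u. u \<in> {1..n} \<rightarrow>\<^sub>E (UNIV :: nat set) \<and>
    staircase a = finprod (\<A>_upto_monoid n) (\<lambda>j. F j [^]\<^bsub>\<A>_upto_monoid n\<^esub> u j) {1..n}"
proof -
  have "finprod (\<A>_upto_monoid n) (\<lambda>j. F j [^]\<^bsub>\<A>_upto_monoid n\<^esub> u j) {1..n} = staircase (initial_part u n)" for u
    by (rule finprod_F[OF comm_monoid_A_upto])
      (auto simp: \<A>_upto_monoid_def submodule_monoid_def staircase_in_A_upto_iff)
  moreover have "staircase a = staircase (initial_part u n) \<longleftrightarrow> (\<forall>j\<in>{1..n}. u j = a j)" for u
    using assms by (auto simp: staircase_eq_iff initial_part_def \<M>_upto_def split: if_splits)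
  moreover have "\<exists>!u. u \<in> {1..n} \<rightarrow>\<^sub>E (UNIV :: nat set) \<and> (\<forall>j\<in>{1..n}. u j = a j)"
    by (rule ex1I[of _ "restrict a {1..n}"]) (auto intro!: PiE_ext[of _ "{1..n}" "\<lambda>_. UNIV"])
  ultimately show ?thesis by simp
qed

lemma inj_on_F: "inj_on F {1..n}"
proof (rule inj_onI)
  fix i j assume ij: "i \<in> {1..n}" "j \<in> {1..n}" "F i = F j"
  then have "staircase (\<lambda>l. if l = i then 1 else 0) = staircase (\<lambda>l. if l = j then 1 else 0)"
    by (simp add: F_eq_staircase)
  then show "i = j" using ij(1) unfolding staircase_eq_iff by (auto split: if_splits)
qed

lemma F_in_A_upto: "1 \<le> j \<Longrightarrow> j \<le> n \<Longrightarrow> F j \<in> \<A>_upto n"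
  by (simp add: F_eq_staircase staircase_in_A_upto_iff)

lemma free_A_upto: "free_comm_monoid_finite_rank (\<A>_upto_monoid n)"
proof (rule free_comm_monoid_if_coordinates[OF comm_monoid_A_upto _ inj_on_F])
  show "F \<in> {1..n} \<rightarrow> carrier (\<A>_upto_monoid n)" by (auto simp: \<A>_upto_monoid_def F_in_A_upto)
  fix L assume "L \<in> carrier (\<A>_upto_monoid n)"
  then obtain a where "a \<in> carrier (\<M>_upto n)" "L = staircase a"
    by (auto simp: \<A>_upto_monoid_def A_upto_eq)
  then show "\<exists>!u. u \<in> {1..n} \<rightarrow>\<^sub>E (UNIV :: nat set) \<and>
      L = finprod (\<A>_upto_monoid n) (\<lambda>j. F j [^]\<^bsub>\<A>_upto_monoid n\<^esub> u j) {1..n}"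
    using A_upto_coordinates by simp
qed

text \<open>The unit vectors correspond to the generators \<open>F j\<close>, whose coordinates are already known to be
  unique.\<close>
lemma free_M_upto: "free_comm_monoid_finite_rank (\<M>_upto n)"
proof -
  define e :: "nat \<Rightarrow> nat \<Rightarrow> nat" where "e = (\<lambda>j. \<lambda>i\<in>{1..}. if i = j then 1 else 0)"
  have e: "e \<in> {1..n} \<rightarrow> carrier (\<M>_upto n)" by (auto simp: e_def \<M>_upto_def carrier_M)
  have Fe: "staircase (e j) = F j" if "j \<in> {1..n}" for j
    using that by (subst F_eq_staircase) (auto simp: e_def intro!: staircase_cong)
  have F_carrier: "F j \<in> carrier (\<A>_upto_monoid n)" if "j \<in> {1..n}" for j
    using that by (simp add: carrier_A_upto F_in_A_upto)
  interpret G: comm_monoid "\<M>_upto n" by (rule comm_monoid_M_upto)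
  interpret H: comm_monoid "\<A>_upto_monoid n" by (rule comm_monoid_A_upto)
  have h: "staircase \<in> hom (\<M>_upto n) (\<A>_upto_monoid n)" "inj_on staircase (carrier (\<M>_upto n))"
    using iso_staircase_upto[of n] by (auto simp: iso_def bij_betw_def)
  have one: "staircase \<one>\<^bsub>\<M>_upto n\<^esub> = \<one>\<^bsub>\<A>_upto_monoid n\<^esub>"
    by (auto simp: \<M>_upto_def M_simps \<A>_upto_monoid_def submodule_monoid_def quadrant_eq_staircase intro!: staircase_cong)
  have image: "staircase (finprod (\<M>_upto n) (\<lambda>j. e j [^]\<^bsub>\<M>_upto n\<^esub> u j) {1..n})
      = finprod (\<A>_upto_monoid n) (\<lambda>j. F j [^]\<^bsub>\<A>_upto_monoid n\<^esub> u j) {1..n}" for u :: "nat \<Rightarrow> nat"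
  proof -
    have "staircase (finprod (\<M>_upto n) (\<lambda>j. e j [^]\<^bsub>\<M>_upto n\<^esub> u j) {1..n})
        = finprod (\<A>_upto_monoid n) (\<lambda>j. staircase (e j) [^]\<^bsub>\<A>_upto_monoid n\<^esub> u j) {1..n}"
      by (rule hom_finprod_pow[OF comm_monoid_M_upto comm_monoid_A_upto h(1) one _ e]) simp
    also have "\<dots> = finprod (\<A>_upto_monoid n) (\<lambda>j. F j [^]\<^bsub>\<A>_upto_monoid n\<^esub> u j) {1..n}"
      using F_carrier Fe by (intro H.finprod_cong') (auto intro!: H.nat_pow_closed)
    finally show ?thesis .
  qed
  show ?thesis
  proof (rule free_comm_monoid_if_coordinates[OF comm_monoid_M_upto e])
    show "inj_on e {1..n}"
    proof (rule inj_onI)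
      fix i j assume ij: "i \<in> {1..n}" "j \<in> {1..n}" "e i = e j"
      have "F i = F j" using Fe[OF ij(1)] Fe[OF ij(2)] unfolding ij(3) by simp
      then show "i = j" using ij(1,2) by (rule inj_onD[OF inj_on_F])
    qed
    fix a assume a: "a \<in> carrier (\<M>_upto n)"
    have "a = finprod (\<M>_upto n) (\<lambda>j. e j [^]\<^bsub>\<M>_upto n\<^esub> u j) {1..n} \<longleftrightarrow>
        staircase a = finprod (\<A>_upto_monoid n) (\<lambda>j. F j [^]\<^bsub>\<A>_upto_monoid n\<^esub> u j) {1..n}" for u :: "nat \<Rightarrow> nat"
      unfolding image[symmetric] using a e by (subst inj_on_eq_iff[OF h(2)]) (auto intro!: G.finprod_closed)
    then show "\<exists>!u. u \<in> {1..n} \<rightarrow>\<^sub>E (UNIV :: nat set) \<and> a = finprod (\<M>_upto n) (\<lambda>j. e j [^]\<^bsub>\<M>_upto n\<^esub> u j) {1..n}"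
      using A_upto_coordinates[OF a] by simp
  qed
qed

theorem theorem21:
  shows "(\<forall>a\<in>carrier \<M>.
            limitin \<A>_topology (partial_sum a) (\<eta> a) sequentially \<and> \<eta> a \<in> \<A> \<and>
            (\<forall>j\<ge>1. w (\<eta> a) j = a j)) \<and>
         topological_monoid_iso \<M> \<M>_topology \<A>_monoid \<A>_topology \<eta> \<and>
         (\<forall>n\<ge>1.
            topological_monoid_iso
              (\<M>_upto n) (subtopology \<M>_topology (carrier (\<M>_upto n)))
              (\<A>_upto_monoid n) (\<A>_upto_topology n) \<eta> \<and>
            subtopology \<M>_topology (carrier (\<M>_upto n)) = discrete_topology (carrier (\<M>_upto n)) \<and>
            \<A>_upto_topology n = discrete_topology (\<A>_upto n) \<and>
            free_comm_monoid_finite_rank (\<M>_upto n) \<and>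
            free_comm_monoid_finite_rank (\<A>_upto_monoid n) \<and>
            (\<forall>a\<in>carrier (\<M>_upto n). \<eta> a = partial_sum a n))"
  unfolding eta_eq_staircase
proof (intro conjI ballI allI impI)
  fix a :: "nat \<Rightarrow> nat"
  show "limitin \<A>_topology (partial_sum a) (staircase a) sequentially" by (rule limitin_partial_sum)
  show "staircase a \<in> \<A>" by (rule staircase_in_A)
  show "w (staircase a) j = a j" if "1 \<le> j" for j using that by (rule w_staircase)
next
  have "Group.monoid \<A>_monoid" using comm_monoid_A by (simp add: comm_monoid_def)
  then show "topological_monoid_iso \<M> \<M>_topology \<A>_monoid \<A>_topology staircase"
    unfolding topological_monoid_iso_def
    using topological_monoid_transport[OF topological_monoid_M iso_staircase _ homeomorphic_map_staircase]
    by (simp add: topological_monoid_M iso_staircase homeomorphic_map_staircase)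
next
  fix n :: nat
  have "Group.monoid (\<M>_upto n)" "Group.monoid (\<A>_upto_monoid n)"
    using comm_monoid_M_upto comm_monoid_A_upto by (simp_all add: comm_monoid_def)
  from topological_monoid_discrete[OF this(1)] topological_monoid_discrete[OF this(2)]
  show "topological_monoid_iso (\<M>_upto n) (subtopology \<M>_topology (carrier (\<M>_upto n)))
      (\<A>_upto_monoid n) (\<A>_upto_topology n) staircase"
    unfolding topological_monoid_iso_def
    using homeomorphic_map_staircase_upto[of n]
    by (simp add: iso_staircase_upto M_upto_discrete A_upto_discrete carrier_A_upto)
  show "subtopology \<M>_topology (carrier (\<M>_upto n)) = discrete_topology (carrier (\<M>_upto n))"
    by (rule M_upto_discrete)
  show "\<A>_upto_topology n = discrete_topology (\<A>_upto n)" by (rule A_upto_discrete)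
  show "free_comm_monoid_finite_rank (\<M>_upto n)" by (rule free_M_upto)
  show "free_comm_monoid_finite_rank (\<A>_upto_monoid n)" by (rule free_A_upto)
  fix a assume "a \<in> carrier (\<M>_upto n)"
  then show "staircase a = partial_sum a n"
    unfolding partial_sum_eq_staircase
    by (intro staircase_cong) (auto simp: initial_part_def \<M>_upto_def)
qed

end
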